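(* Let $\mathcal{T}_0$ be a finite tree with $|\mathcal{T}_0|\ge 2$ vertices and Wiener index $\mathcal{W}_0$. Let $\mathcal{T}^{\star}_0=\mathcal{T}_0$ and, for each $t\ge1$, let $\mathcal{T}^{\star}_t$ be obtained from $\mathcal{T}^{\star}_{t-1}$ by attaching $2k_v(t-1)$ new leaves to each vertex $v$ of $\mathcal{T}^{\star}_{t-1}$, where $k_v(t-1)$ is the degree of $v$ in $\mathcal{T}^{\star}_{t-1}$. Then for every $t\ge0$ the mean hitting time $\langle\mathcal{H}^{\star}_t\rangle$ of the simple random walk on $\mathcal{T}^{\star}_t$ is $$\langle\mathcal{H}^{\star}_{t}\rangle=\frac{2}{5^{t}(|\mathcal{T}_{0}|-1)+1}\left[25^{t}\,\mathcal{W}_{0}+10\,t\cdot5^{2(t-1)}(|\mathcal{T}_{0}|-1)^{2}-\frac{3(5^{2t-1}-5^{t-1})}{2}(|\mathcal{T}_{0}|-1)\right],$$ and, as $t\to\infty$, $$\langle\mathcal{H}^{\star}_t\rangle\sim|\mathcal{T}^{\star}_t|\,\ln|\mathcal{T}^{\star}_t|,$$ where $\sim$ means equality of order up to positive constants (which may depend on $\mathcal{T}_0$).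
   Context: $|\mathcal{T}|$ denotes the number of vertices of a tree $\mathcal{T}$. The Wiener index of a tree is $\mathcal{W}_{\mathcal{T}}=\frac12\sum_{u,v\in\mathcal{T}}d_{uv}$ (sum over ordered pairs), with $d_{uv}$ the graph distance; $\mathcal{W}_0=\mathcal{W}_{\mathcal{T}_0}$. The simple random walk moves from its current vertex $u$ to each neighbor with probability $1/\deg(u)$; the hitting time $\mathcal{H}_{u\to v}$ is the expected number of steps for the walk started at $u$ to first reach $v$ (with $\mathcal{H}_{u\to u}=0$). The mean hitting time of a graph with vertex set $\mathcal{V}$ is $\frac{1}{|\mathcal{V}|(|\mathcal{V}|-1)}\sum_{u,v\in\mathcal{V}}\mathcal{H}_{u\to v}$ (sum over ordered pairs); $\langle\mathcal{H}^{\star}_t\rangle$ is this quantity for $\mathcal{T}^{\star}_t$. *)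

theory Defs
  imports "HOL-Probability.Probability" "HOL-Library.Landau_Symbols" "Graph_Theory.Graph_Theory"
begin

text \<open>
  Finite simple graphs are rendered by the locale \<open>pair_graph\<close>: finite, loopless, with a symmetric
  set of arcs, so that every undirected edge contributes the two arcs \<open>(u, v)\<close> and \<open>(v, u)\<close>.
  Consequently \<open>out_degree\<close> is the degree of a vertex. Moreover \<open>(u, v), (v, u)\<close> always is
  a \<open>cycle\<close> of length 2 in the sense of the library, so the predicate \<open>tree\<close>
  of \<open>Digraph_Component\<close> is not the one for undirected graphs; cycles of an undirected graph have
  length at least 3. The constant \<open>connected\<close> must be qualified because of its
  topological namesake; it includes that the graph is nonempty.
\<close>

definition finite_tree :: "'a pair_pre_digraph \<Rightarrow> bool" where
  "finite_tree G \<longleftrightarrow> pair_graph G \<and> Digraph_Component.connected (with_proj G) \<and>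
     \<not> (\<exists>p. pre_digraph.cycle (with_proj G) p \<and> 3 \<le> length p)"

definition graph_dist :: "'a pair_pre_digraph \<Rightarrow> 'a \<Rightarrow> 'a \<Rightarrow> real" where
  "graph_dist G u v = real_of_ereal (wf_digraph.\<mu> (with_proj G) (\<lambda>_. 1) u v)"

definition wiener_index :: "'a pair_pre_digraph \<Rightarrow> real" where
  "wiener_index G = (1/2) * (\<Sum>u\<in>pverts G. \<Sum>v\<in>pverts G. graph_dist G u v)"

text \<open>
  \<open>H\<close> arises from \<open>G\<close> by attaching \<open>2 k\<^sub>v\<close> new leaves to every vertex \<open>v\<close> of \<open>G\<close>, \<open>k\<^sub>v\<close> being the
  degree of \<open>v\<close> in \<open>G\<close>. Here \<open>L\<close> is the set of new leaves and \<open>p w\<close> the vertex that \<open>w\<close> is attached to.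
\<close>

definition leaf_attachment :: "'a pair_pre_digraph \<Rightarrow> 'a pair_pre_digraph \<Rightarrow> bool" where
  "leaf_attachment G H \<longleftrightarrow> (\<exists>L p. finite L \<and> L \<inter> pverts G = {} \<and> p ` L \<subseteq> pverts G \<and>
     (\<forall>v\<in>pverts G. card {w \<in> L. p w = v} = 2 * out_degree (with_proj G) v) \<and>
     pverts H = pverts G \<union> L \<and>
     parcs H = parcs G \<union> {(w, p w) |w. w \<in> L} \<union> {(p w, w) |w. w \<in> L})"

text \<open>
  Law of the simple random walk started at \<open>u\<close>, as a measure on trajectories: given the first \<open>n\<close>
  positions, the next one is drawn according to \<open>walk_kernel G u n\<close>.
\<close>

definition walk_kernel ::
  "'a pair_pre_digraph \<Rightarrow> 'a \<Rightarrow> nat \<Rightarrow> (nat \<Rightarrow> 'a) \<Rightarrow> 'a measure" where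
  "walk_kernel G u n \<omega> = measure_pmf
     (case n of 0 \<Rightarrow> return_pmf u | Suc m \<Rightarrow> pmf_of_set {w. (\<omega> m, w) \<in> parcs G})"

definition walk_measure :: "'a pair_pre_digraph \<Rightarrow> 'a \<Rightarrow> (nat \<Rightarrow> 'a) measure" where
  "walk_measure G u = projective_family.lim UNIV
     (Ionescu_Tulcea.CI (walk_kernel G u) (\<lambda>_. count_space UNIV)) (\<lambda>_. count_space UNIV)"

text \<open>The infimum is \<open>\<infinity>\<close> on trajectories that never visit \<open>v\<close>.\<close>

definition hitting_time :: "'a pair_pre_digraph \<Rightarrow> 'a \<Rightarrow> 'a \<Rightarrow> ennreal" where
  "hitting_time G u v = (\<integral>\<^sup>+ \<omega>. (INF n\<in>{n. \<omega> n = v}. of_nat n) \<partial>walk_measure G u)"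

definition mean_hitting_time :: "'a pair_pre_digraph \<Rightarrow> ennreal" where
  "mean_hitting_time G = (\<Sum>u\<in>pverts G. \<Sum>v\<in>pverts G. hitting_time G u v) /
     of_nat (card (pverts G) * (card (pverts G) - 1))"

text \<open>The kernels satisfy the hypotheses of the Ionescu-Tulcea theorem, so \<open>walk_measure\<close>
  has the intended finite-dimensional distributions.\<close>

lemma Ionescu_Tulcea_walk:
  fixes G :: "'a pair_pre_digraph"
  shows "Ionescu_Tulcea (walk_kernel G u) (\<lambda>_. count_space UNIV)"
proof (rule Ionescu_Tulcea.intro)
  fix i :: nat
  show "walk_kernel G u i \<in> measurable (PiM {0..<i} (\<lambda>_. count_space UNIV))
          (subprob_algebra (count_space UNIV))"
  proof (cases i)
    case 0
    show ?thesis
      unfolding walk_kernel_def 0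
      by (simp add: measurable_const measure_pmf_in_subprob_algebra)
  next
    case (Suc m)
    have "(\<lambda>x. measure_pmf (pmf_of_set {w. (x, w) \<in> parcs G}))
        \<in> measurable (count_space UNIV) (subprob_algebra (count_space UNIV))"
      by (simp add: measure_pmf_in_subprob_algebra)
    moreover have "(\<lambda>\<omega>::nat \<Rightarrow> 'a. \<omega> m) \<in> measurable (PiM {0..<Suc m} (\<lambda>_. count_space UNIV)) (count_space UNIV)"
      by (rule measurable_component_singleton) simp
    ultimately have "(\<lambda>\<omega>. measure_pmf (pmf_of_set {w. (\<omega> m, w) \<in> parcs G}))
        \<in> measurable (PiM {0..<Suc m} (\<lambda>_. count_space UNIV)) (subprob_algebra (count_space UNIV))"
      by (rule measurable_compose[rotated])
    then show ?thesis
      unfolding walk_kernel_def Suc by simp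
  qed
next
  fix i x
  show "prob_space (walk_kernel G u i x)"
    unfolding walk_kernel_def by (rule prob_space_measure_pmf)
qed

text \<open>On an infinite type of vertices, the construction can always be carried out.\<close>

lemma leaf_attachment_exists:
  fixes G :: "'a pair_pre_digraph"
  assumes inf: "infinite (UNIV :: 'a set)" and fin: "finite (pverts G)"
  shows "\<exists>H. leaf_attachment G H \<and> finite (pverts H)"
proof -
  define S where "S = (SIGMA v:pverts G. {..<2 * out_degree (with_proj G) v})"
  have S: "finite S" unfolding S_def using fin by auto
  have "infinite (- pverts G)" using inf fin by (simp add: Compl_eq_Diff_UNIV)
  then obtain L where L: "finite L" "card L = card S" "L \<subseteq> - pverts G"
    using infinite_arbitrarily_large by metis
  then obtain f where f: "bij_betw f L S"
    using S finite_same_card_bij by metis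
  define p where "p = fst \<circ> f"
  have p: "p ` L \<subseteq> pverts G"
    using bij_betwE[OF f] by (auto simp: p_def S_def)
  have card: "card {w \<in> L. p w = v} = 2 * out_degree (with_proj G) v" if v: "v \<in> pverts G" for v
  proof -
    have "bij_betw f {w \<in> L. p w = v} ({v} \<times> {..<2 * out_degree (with_proj G) v})"
      unfolding bij_betw_def
    proof
      show "inj_on f {w \<in> L. p w = v}"
        using f by (auto simp: bij_betw_def inj_on_def)
      have "f ` {w \<in> L. p w = v} = {s \<in> f ` L. fst s = v}"
        by (auto simp: p_def)
      also have "f ` L = S"
        using f by (simp add: bij_betw_def)
      also have "{s \<in> S. fst s = v} = {v} \<times> {..<2 * out_degree (with_proj G) v}"
        using v by (auto simp: S_def)
      finally show "f ` {w \<in> L. p w = v} = {v} \<times> {..<2 * out_degree (with_proj G) v}" .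
    qed
    from bij_betw_same_card[OF this] show ?thesis
      by (simp add: card_cartesian_product)
  qed
  define H where "H = \<lparr>pverts = pverts G \<union> L,
    parcs = parcs G \<union> {(w, p w) |w. w \<in> L} \<union> {(p w, w) |w. w \<in> L}\<rparr>"
  have "leaf_attachment G H"
    unfolding leaf_attachment_def H_def
    using L p card by (intro exI[of _ L] exI[of _ p]) auto
  moreover have "finite (pverts H)"
    using fin L by (simp add: H_def)
  ultimately show ?thesis by blast
qed

lemma leaf_attachment_sequence_exists:
  fixes G :: "'a pair_pre_digraph"
  assumes "infinite (UNIV :: 'a set)" "finite (pverts G)"
  shows "\<exists>T. T 0 = G \<and> (\<forall>t. leaf_attachment (T t) (T (Suc t)))"
proof -
  have "\<exists>T. T 0 = G \<and> (\<forall>t. finite (pverts (T t)) \<and> leaf_attachment (T t) (T (Suc t)))"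
    using dependent_nat_choice[of "\<lambda>n H. finite (pverts H) \<and> (n = 0 \<longrightarrow> H = G)"
        "\<lambda>_. leaf_attachment"] leaf_attachment_exists[OF assms(1)] assms(2)
    by (metis nat.distinct(1))
  then show ?thesis by blast
qed

end

theory Submission
  imports Defs "HOL-Library.Transitive_Closure_Table" "HOL-Real_Asymp.Real_Asymp"
begin

text \<open>
  On a tree the function \<open>h u = 1/2 * (\<Sum>z. deg z * (d u v + d v z - d u z))\<close> satisfies the first-step
  equations for the hitting time of \<open>v\<close>, because every \<open>x \<noteq> a\<close> has exactly one neighbour closer to \<open>a\<close>
  and all others are farther away. Summing over all pairs, the last two terms cancel and the mean
  hitting time is \<open>2 W / n\<close>. Attaching the leaves turns the number of edges \<open>m\<close> into \<open>5 m\<close> and the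
  Wiener index \<open>W\<close> into \<open>25 W + 10 m\<^sup>2 - 6 m\<close>; solving this recursion gives the formula.
\<close>

section \<open>Distances in trees\<close>

text \<open>The parent property is made an axiom because it survives the attachment of leaves with
  an explicit new distance; cycles are thus examined for the initial tree only. The recursion closes
  in \<open>m\<close> and \<open>W\<close> because degree-weighted distances reduce to plain ones:
  the edge from \<open>x\<close> to its parent towards \<open>a\<close> contributes
  \<open>2 * d x a - 1\<close>, so the sum of \<open>deg x * d x a\<close> is
  \<open>2 * (\<Sum>x. d x a) - m\<close>. At stage \<open>t\<close> the term
  \<open>10 * m\<^sup>2\<close> is a multiple of \<open>25 ^ t\<close>, the growth rate of the
  homogeneous recursion; this resonance produces the factor \<open>t\<close>, and with it the
  logarithm. The first-step equations still have to be tied to the walk, whose law is a projective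
  limit: integrals are reduced to finitely many coordinates, and a nonnegative solution is
  identified with the expectation by a remainder that tends to zero.\<close>

locale metric_tree = pair_graph G for G :: "'a pair_pre_digraph" +
  fixes d :: "'a \<Rightarrow> 'a \<Rightarrow> nat"
  assumes dist_self [simp]: "d u u = 0"
    and dist_sym: "d u v = d v u"
    and parent_ex: "u \<in> pverts G \<Longrightarrow> a \<in> pverts G \<Longrightarrow> u \<noteq> a \<Longrightarrow>
      \<exists>p. (u, p) \<in> parcs G \<and> d u a = Suc (d p a) \<and>
          (\<forall>w. (u, w) \<in> parcs G \<longrightarrow> w \<noteq> p \<longrightarrow> d w a = Suc (d u a))"
begin

definition nbrs :: "'a \<Rightarrow> 'a set" where
  "nbrs u = {w. (u, w) \<in> parcs G}"

definition deg :: "'a \<Rightarrow> nat" where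
  "deg u = card (nbrs u)"

lemma nbrs_subset: "nbrs u \<subseteq> pverts G"
  by (auto simp: nbrs_def dest: in_arcsD2)

lemma finite_nbrs [simp]: "finite (nbrs u)"
  using nbrs_subset pair_finite_verts by (rule finite_subset)

lemma out_degree_eq_deg: "out_degree (with_proj G) u = deg u"
proof -
  have "out_arcs (with_proj G) u = Pair u ` nbrs u"
    by (auto simp: out_arcs_def nbrs_def)
  then show ?thesis
    by (simp add: out_degree_def deg_def card_image inj_on_def)
qed

lemma nbrs_sym: "w \<in> nbrs u \<longleftrightarrow> u \<in> nbrs w"
  by (auto simp: nbrs_def intro: arcs_symmetric)

text \<open>Towards \<open>u\<close> itself, the parent of \<open>w\<close> has to be
  \<open>u\<close>: every other neighbour of \<open>w\<close> has a positive distance to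
  \<open>u\<close>, whereas \<open>d u u = 0\<close>.\<close>

lemma dist_nbr: "w \<in> nbrs u \<Longrightarrow> d w u = 1"
proof -
  assume w: "w \<in> nbrs u"
  then have wu: "(w, u) \<in> parcs G" "w \<noteq> u" "w \<in> pverts G" "u \<in> pverts G"
    using arcs_symmetric[of u w] no_loops'[of u w] by (auto simp: nbrs_def dest: in_arcsD1)
  then show ?thesis
    using parent_ex[of w u] by fastforce
qed

lemma dist_pos: "u \<in> pverts G \<Longrightarrow> a \<in> pverts G \<Longrightarrow> u \<noteq> a \<Longrightarrow> d u a > 0"
  using parent_ex[of u a] by auto

lemma deg_pos:
  assumes "u \<in> pverts G" "a \<in> pverts G" "u \<noteq> a"
  shows "deg u > 0"
proof -
  obtain p where "p \<in> nbrs u"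
    using parent_ex[OF assms] by (auto simp: nbrs_def)
  then show ?thesis
    by (auto simp: deg_def card_gt_0_iff)
qed

lemma nbr_dist_le: "a \<in> pverts G \<Longrightarrow> w \<in> nbrs u \<Longrightarrow> d u a \<le> Suc (d w a)"
proof (cases "u = a")
  case False
  assume "a \<in> pverts G" "w \<in> nbrs u"
  then show ?thesis
    using parent_ex[of u a] False in_arcsD1 by (fastforce simp: nbrs_def)
qed auto

lemma awalk_dist_le:
  "awalk u p a \<Longrightarrow> d u a \<le> length p"
proof (induction p arbitrary: u)
  case (Cons e p)
  then have "e \<in> parcs G" "u = fst e" "awalk (snd e) p a" "a \<in> pverts G"
    by (auto simp: awalk_Cons_iff)
  then show ?case
    using Cons.IH[of "snd e"] nbr_dist_le[of a "snd e" u] by (auto simp: nbrs_def)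
qed (auto simp: awalk_Nil_iff)

lemma awalk_dist_ex:
  "u \<in> pverts G \<Longrightarrow> a \<in> pverts G \<Longrightarrow> \<exists>p. awalk u p a \<and> length p = d u a"
proof (induction "d u a" arbitrary: u)
  case 0
  then show ?case
    using dist_pos[of u a] by (auto simp: awalk_Nil_iff intro!: exI[of _ "[]"])
next
  case (Suc n)
  then have "u \<noteq> a" by auto
  then obtain q where q: "(u, q) \<in> parcs G" "d u a = Suc (d q a)"
    using parent_ex[of u a] Suc.prems by auto
  then obtain p where "awalk q p a" "length p = d q a"
    using Suc in_arcsD2 by (metis nat.inject)
  then have "awalk u ((u, q) # p) a" "length ((u, q) # p) = d u a"
    using q by (auto simp: awalk_Cons_iff)
  then show ?case by blast
qed

text \<open>An arc lowers the distance by at most one, and following parents attains this bound. So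
  the axioms determine \<open>d\<close> on the vertices, and the Wiener index can be computed from
  any \<open>d\<close> that satisfies them.\<close>

lemma graph_dist_eq:
  assumes "u \<in> pverts G" "v \<in> pverts G"
  shows "graph_dist G u v = d u v"
proof -
  have cost: "awalk_cost (\<lambda>_. 1) p = real (length p)" for p :: "('a \<times> 'a) list"
    by (induction p) auto
  obtain p where p: "awalk u p v" "length p = d u v"
    using awalk_dist_ex[OF assms] by blast
  have "\<mu> (\<lambda>_. 1) u v = ereal (d u v)"
    unfolding \<mu>_def cost
  proof (rule antisym)
    show "(INF p\<in>{p. awalk u p v}. ereal (real (length p))) \<le> ereal (d u v)"
      using p by (auto intro!: INF_lower2[of p])
    show "ereal (d u v) \<le> (INF p\<in>{p. awalk u p v}. ereal (real (length p)))"
      by (auto intro!: INF_greatest dest: awalk_dist_le)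
  qed
  then show ?thesis
    by (simp add: graph_dist_def)
qed

lemma wiener_index_eq:
  "2 * wiener_index G = (\<Sum>u\<in>pverts G. \<Sum>v\<in>pverts G. real (d u v))"
  by (simp add: wiener_index_def graph_dist_eq)

text \<open>All neighbours are first counted as lying one step farther from \<open>a\<close>; the
  correction then repairs the term of the parent, which exists only for
  \<open>x \<noteq> a\<close>.\<close>

lemma sum_nbrs:
  fixes f :: "nat \<Rightarrow> real"
  assumes "x \<in> pverts G" "a \<in> pverts G"
  shows "(\<Sum>y\<in>nbrs x. f (d y a)) = deg x * f (Suc (d x a)) +
           (if x = a then 0 else f (d x a - 1) - f (Suc (d x a)))"
proof (cases "x = a")
  case True
  then have "(\<Sum>y\<in>nbrs x. f (d y a)) = (\<Sum>y\<in>nbrs x. f (Suc (d x a)))"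
    by (intro sum.cong) (auto simp: dist_nbr)
  then show ?thesis
    using True by (simp add: deg_def)
next
  case False
  then obtain p where p: "p \<in> nbrs x" "d x a = Suc (d p a)"
    "\<And>w. w \<in> nbrs x \<Longrightarrow> w \<noteq> p \<Longrightarrow> d w a = Suc (d x a)"
    using parent_ex[OF assms] by (auto simp: nbrs_def)
  have "(\<Sum>y\<in>nbrs x. f (d y a)) = f (d p a) + (\<Sum>y\<in>nbrs x - {p}. f (d y a))"
    using p by (simp add: sum.remove)
  also have "(\<Sum>y\<in>nbrs x - {p}. f (d y a)) = (\<Sum>y\<in>nbrs x - {p}. f (Suc (d x a)))"
    using p by (intro sum.cong) auto
  also have "\<dots> = (real (deg x) - 1) * f (Suc (d x a))"
    using p(1) by (auto simp: deg_def card_Suc_Diff1[of "nbrs x" p, symmetric] simp del: card_Diff_insert)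
  finally show ?thesis
    using False p(2) by (simp add: algebra_simps)
qed

lemma sum_sum_nbrs:
  fixes f :: "'a \<Rightarrow> real"
  shows "(\<Sum>x\<in>pverts G. \<Sum>y\<in>nbrs x. f y) = (\<Sum>y\<in>pverts G. deg y * f y)"
proof -
  have "(\<Sum>x\<in>pverts G. \<Sum>y\<in>nbrs x. f y) =
      (\<Sum>x\<in>pverts G. \<Sum>y\<in>{y\<in>pverts G. y \<in> nbrs x}. f y)"
    using nbrs_subset by (intro sum.cong refl) auto
  also have "\<dots> = (\<Sum>y\<in>pverts G. \<Sum>x\<in>{x\<in>pverts G. y \<in> nbrs x}. f y)"
    by (rule sum.swap_restrict) (auto simp: pair_finite_verts)
  also have "\<dots> = (\<Sum>y\<in>pverts G. \<Sum>x\<in>nbrs y. f y)"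
  proof (intro sum.cong refl)
    fix y
    show "{x\<in>pverts G. y \<in> nbrs x} = nbrs y"
      using nbrs_subset[of y] nbrs_sym by auto
  qed
  finally show ?thesis
    by (simp add: deg_def)
qed

text \<open>Double counting of \<open>f (d y a)\<close> over all arcs \<open>(x, y)\<close>: linear \<open>f\<close> yields the number of edges,
  quadratic \<open>f\<close> the distances weighted by degrees.\<close>

lemma sum_deg_dist_double_count:
  fixes f :: "nat \<Rightarrow> real"
  assumes "a \<in> pverts G"
  shows "(\<Sum>x\<in>pverts G. deg x * f (d x a)) = (\<Sum>x\<in>pverts G. deg x * f (Suc (d x a))) +
     (\<Sum>x\<in>pverts G - {a}. f (d x a - 1) - f (Suc (d x a)))"
proof -
  have "(\<Sum>x\<in>pverts G. deg x * f (d x a)) = (\<Sum>x\<in>pverts G. \<Sum>y\<in>nbrs x. f (d y a))"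
    by (rule sum_sum_nbrs[symmetric])
  also have "\<dots> = (\<Sum>x\<in>pverts G. deg x * f (Suc (d x a)) +
           (if x = a then 0 else f (d x a - 1) - f (Suc (d x a))))"
    using assms by (intro sum.cong refl sum_nbrs)
  also have "(\<Sum>x\<in>pverts G. (if x = a then 0 else f (d x a - 1) - f (Suc (d x a)))) =
     (\<Sum>x\<in>pverts G - {a}. f (d x a - 1) - f (Suc (d x a)))"
    by (rule sum.mono_neutral_cong_right) (auto simp: pair_finite_verts)
  ultimately show ?thesis
    by (simp add: sum.distrib)
qed

abbreviation nv :: real where "nv \<equiv> real (card (pverts G))"

lemma sum_deg:
  assumes "pverts G \<noteq> {}"
  shows "(\<Sum>x\<in>pverts G. real (deg x)) = 2 * (nv - 1)"
proof -
  obtain a where a: "a \<in> pverts G" using assms by auto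
  have "(\<Sum>x\<in>pverts G. real (deg x) * d x a) = (\<Sum>x\<in>pverts G. real (deg x) * (Suc (d x a))) +
     (\<Sum>x\<in>pverts G - {a}. real (d x a - 1) - real (Suc (d x a)))"
    by (rule sum_deg_dist_double_count[OF a])
  also have "(\<Sum>x\<in>pverts G - {a}. real (d x a - 1) - real (Suc (d x a))) =
     (\<Sum>x\<in>pverts G - {a}. - 2)"
  proof (intro sum.cong refl)
    fix x assume "x \<in> pverts G - {a}"
    then show "real (d x a - 1) - real (Suc (d x a)) = - 2"
      using dist_pos[of x a] a by (auto simp: of_nat_diff Suc_le_eq)
  qed
  also have "\<dots> = - 2 * (nv - 1)"
    using a pair_finite_verts by (subst card_Suc_Diff1[of "pverts G" a, symmetric]) auto
  finally show ?thesis
    by (simp add: algebra_simps sum.distrib)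
qed

text \<open>For squares, a vertex at distance k > 0 has the correction (k - 1)^2 - (k + 1)^2 = -4 k,
  while the weight of \<open>deg x\<close> becomes (k + 1)^2 - k^2 = 2 k + 1. The constant part of
  the latter is evaluated by \<open>sum_deg\<close>.\<close>

lemma sum_deg_dist:
  assumes a: "a \<in> pverts G"
  shows "(\<Sum>x\<in>pverts G. real (deg x) * d x a) = 2 * (\<Sum>x\<in>pverts G. real (d x a)) - (nv - 1)"
proof -
  have "(\<Sum>x\<in>pverts G. real (deg x) * (d x a)\<^sup>2) = (\<Sum>x\<in>pverts G. real (deg x) * (Suc (d x a))\<^sup>2) +
     (\<Sum>x\<in>pverts G - {a}. (d x a - 1)\<^sup>2 - real ((Suc (d x a))\<^sup>2))"
    using sum_deg_dist_double_count[OF a, of "\<lambda>n. real (n\<^sup>2)"] by simp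
  also have "(\<Sum>x\<in>pverts G - {a}. real ((d x a - 1)\<^sup>2) - real ((Suc (d x a))\<^sup>2)) =
     (\<Sum>x\<in>pverts G - {a}. - 4 * real (d x a))"
  proof (intro sum.cong refl)
    fix x assume "x \<in> pverts G - {a}"
    then obtain k where "d x a = Suc k"
      using dist_pos[of x a] a by (auto simp: gr0_conv_Suc)
    then show "real ((d x a - 1)\<^sup>2) - real ((Suc (d x a))\<^sup>2) = - 4 * real (d x a)"
      by (simp add: power2_eq_square algebra_simps)
  qed
  also have "\<dots> = - 4 * (\<Sum>x\<in>pverts G. real (d x a))"
    using a pair_finite_verts by (subst (2) sum.remove[of _ a]) (auto simp: sum_distrib_left)
  finally have "4 * (\<Sum>x\<in>pverts G. real (d x a)) =
      (\<Sum>x\<in>pverts G. real (deg x) * (Suc (d x a))\<^sup>2 - real (deg x) * (d x a)\<^sup>2)"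
    by (simp add: sum_subtractf)
  also have "\<dots> = (\<Sum>x\<in>pverts G. 2 * (real (deg x) * d x a) + real (deg x))"
    by (intro sum.cong) (auto simp: power2_eq_square algebra_simps)
  also have "\<dots> = 2 * (\<Sum>x\<in>pverts G. real (deg x) * d x a) + 2 * (nv - 1)"
    using sum_deg a by (auto simp: sum.distrib sum_distrib_left)
  finally show ?thesis by simp
qed

text \<open>On a tree the effective resistance is the distance, so this is the classical expression of
  hitting times by resistances.\<close>

definition hit :: "'a \<Rightarrow> 'a \<Rightarrow> real" where
  "hit v u = (\<Sum>z\<in>pverts G. real (deg z) * (real (d u v) + d v z - d u z)) / 2"

lemma hit_self: "hit v v = 0"
  by (simp add: hit_def)

text \<open>Averaged over the neighbours \<open>y\<close> of \<open>x\<close>, the distance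
  \<open>d y a\<close> is \<open>d x a + 1 - 2 / deg x\<close> for \<open>a \<noteq> x\<close> and
  \<open>d x a + 1\<close> for \<open>a = x\<close>. In the difference \<open>d y v - d y z\<close>
  these changes cancel for every \<open>z \<noteq> x\<close>; at \<open>z = x\<close> the defect
  \<open>- 2 / deg x\<close> is left, and the weight \<open>deg z / 2\<close> turns it into
  -1.\<close>

lemma hit_step:
  assumes x: "x \<in> pverts G" and v: "v \<in> pverts G" and xv: "x \<noteq> v"
  shows "(\<Sum>y\<in>nbrs x. hit v y) / deg x = hit v x - 1"
proof -
  have k: "real (deg x) > 0"
    using deg_pos[OF assms] by simp
  have *: "(\<Sum>y\<in>nbrs x. real (d y a)) = deg x * (1 + real (d x a)) - (if x = a then 0 else 2)"
    if "a \<in> pverts G" for a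
    using sum_nbrs[OF x that, of real] dist_pos[OF x that] by (auto simp: of_nat_diff Suc_le_eq)
  have "2 * (\<Sum>y\<in>nbrs x. hit v y) =
      (\<Sum>y\<in>nbrs x. \<Sum>z\<in>pverts G. real (deg z) * (real (d y v) + d v z - d y z))"
    by (subst sum_distrib_left) (simp add: hit_def)
  also have "\<dots> = (\<Sum>z\<in>pverts G. \<Sum>y\<in>nbrs x. real (deg z) * (real (d y v) + d v z - d y z))"
    by (rule sum.swap)
  also have "\<dots> = (\<Sum>z\<in>pverts G. real (deg z) *
      ((\<Sum>y\<in>nbrs x. real (d y v)) + deg x * d v z - (\<Sum>y\<in>nbrs x. real (d y z))))"
    by (simp add: sum_distrib_left sum.distrib sum_subtractf deg_def algebra_simps)
  also have "\<dots> = (\<Sum>z\<in>pverts G. deg x * (real (deg z) * (real (d x v) + d v z - d x z))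
      - (if z = x then 2 * real (deg z) else 0))"
    using v xv by (intro sum.cong refl) (auto simp: * algebra_simps)
  also have "\<dots> = deg x * (2 * hit v x) - 2 * deg x"
    using x pair_finite_verts by (simp add: sum_subtractf sum_distrib_left[symmetric] hit_def)
  finally show ?thesis
    using k by (simp add: field_simps)
qed

lemma sum_hit:
  assumes "pverts G \<noteq> {}"
  shows "(\<Sum>u\<in>pverts G. \<Sum>v\<in>pverts G. hit v u) = 2 * (nv - 1) * wiener_index G"
proof -
  let ?V = "pverts G"
  let ?B = "\<Sum>u\<in>?V. \<Sum>z\<in>?V. real (deg z) * d u z"
  have "2 * hit v u = 2 * (nv - 1) * d u v + (\<Sum>z\<in>?V. real (deg z) * d v z) -
      (\<Sum>z\<in>?V. real (deg z) * d u z)" for u v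
  proof -
    have "2 * hit v u = (\<Sum>z\<in>?V. real (deg z) * (real (d u v) + d v z - d u z))"
      by (simp add: hit_def)
    also have "\<dots> = (\<Sum>z\<in>?V. real (deg z)) * d u v + (\<Sum>z\<in>?V. real (deg z) * d v z) -
      (\<Sum>z\<in>?V. real (deg z) * d u z)"
      by (simp add: sum_distrib_right sum.distrib sum_subtractf ring_distribs)
    finally show ?thesis by (simp only: sum_deg[OF assms])
  qed
  then have "2 * (\<Sum>u\<in>?V. \<Sum>v\<in>?V. hit v u) = (\<Sum>u\<in>?V. \<Sum>v\<in>?V. 2 * (nv - 1) * d u v +
     (\<Sum>z\<in>?V. real (deg z) * d v z) - (\<Sum>z\<in>?V. real (deg z) * d u z))"
    by (simp only: sum_distrib_left)
  also have "\<dots> = 2 * (nv - 1) * (2 * wiener_index G) + nv * ?B - nv * ?B"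
    by (simp add: wiener_index_eq sum.distrib sum_subtractf sum_distrib_left)
  finally show ?thesis by simp
qed

end

section \<open>Hitting times of the simple random walk\<close>

lemma sets_walk_measure:
  fixes G :: "'a pair_pre_digraph"
  shows "sets (walk_measure G u) = sets (PiM UNIV (\<lambda>_. count_space UNIV))"
proof -
  interpret IT: Ionescu_Tulcea "walk_kernel G u" "\<lambda>_. count_space (UNIV :: 'a set)"
    by (rule Ionescu_Tulcea_walk)
  show ?thesis
    by (simp add: walk_measure_def)
qed

text \<open>This replaces the projective limit by a finite composition of kernels, which can be
  unfolded one step at a time.\<close>

lemma nn_integral_walk_measure_restrict:
  fixes G :: "'a pair_pre_digraph"
  defines "M \<equiv> \<lambda>_::nat. count_space (UNIV :: 'a set)"
  assumes f [measurable]: "f \<in> borel_measurable (PiM {0..<n} M)"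
  shows "(\<integral>\<^sup>+\<omega>. f (restrict \<omega> {0..<n}) \<partial>walk_measure G u) =
    (\<integral>\<^sup>+\<omega>. f \<omega> \<partial>Ionescu_Tulcea.C (walk_kernel G u) M 0 n (\<lambda>_. undefined))"
proof -
  interpret IT: Ionescu_Tulcea "walk_kernel G u" M
    unfolding M_def by (rule Ionescu_Tulcea_walk)
  have wm: "walk_measure G u = IT.PF.lim"
    by (simp add: walk_measure_def M_def)
  \<comment> \<open>\<open>CI J\<close> is the marginal on \<open>J\<close> of the composition up to
    \<open>up_to J\<close>, the least initial segment containing \<open>J\<close>; here that segment
    is \<open>{0..<n}\<close> itself.\<close>
  have up: "IT.up_to {0..<n} = n"
    using IT.up_to_less[of "{0..<n}" "n - 1"] IT.up_to_iff[of "{0..<n}" n]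
    by (cases n) (auto intro: antisym)
  have sp: "(\<lambda>_. undefined) \<in> space (PiM {0..<0} M)"
    by (simp add: space_PiM)
  have *: "restrict \<omega> {0..<n} = \<omega>" if "\<omega> \<in> space (IT.C 0 n (\<lambda>_. undefined))" for \<omega>
    using that IT.space_C[OF sp, of n] by (auto simp: space_PiM PiE_iff extensional_restrict)
  have m1: "(\<lambda>\<omega>. restrict \<omega> {0..<n}) \<in> measurable (IT.C 0 n (\<lambda>_. undefined)) (PiM {0..<n} M)"
    using measurable_cong_sets[OF IT.sets_C[OF sp, of n] refl]
    by (auto intro!: measurable_restrict)
  have m2: "(\<lambda>\<omega>. restrict \<omega> {0..<n}) \<in> measurable IT.PF.lim (PiM {0..<n} M)"
    by (subst measurable_cong_sets[OF IT.PF.sets_lim refl])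
      (intro measurable_restrict measurable_component_singleton UNIV_I)
  have "(\<integral>\<^sup>+\<omega>. f (restrict \<omega> {0..<n}) \<partial>walk_measure G u) =
      (\<integral>\<^sup>+\<omega>. f \<omega> \<partial>distr IT.PF.lim (PiM {0..<n} M) (\<lambda>\<omega>. restrict \<omega> {0..<n}))"
    unfolding wm by (rule nn_integral_distr[OF m2, symmetric]) (simp add: f)
  also have "\<dots> = (\<integral>\<^sup>+\<omega>. f \<omega> \<partial>IT.CI {0..<n})"
    by (simp add: IT.distr_lim)
  also have "\<dots> = (\<integral>\<^sup>+\<omega>. f (restrict \<omega> {0..<n}) \<partial>IT.C 0 n (\<lambda>_. undefined))"
    unfolding IT.CI_def up by (rule nn_integral_distr[OF m1]) (simp add: f)
  also have "\<dots> = (\<integral>\<^sup>+\<omega>. f \<omega> \<partial>IT.C 0 n (\<lambda>_. undefined))"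
    by (intro nn_integral_cong) (simp add: *)
  finally show ?thesis .
qed

text \<open>The bound is strict, so \<open>avoids v (Suc n)\<close> is the event that the hitting
  time of \<open>v\<close> exceeds \<open>n\<close>.\<close>

definition avoids :: "'a \<Rightarrow> nat \<Rightarrow> (nat \<Rightarrow> 'a) \<Rightarrow> bool" where
  "avoids v n \<omega> \<longleftrightarrow> (\<forall>k<n. \<omega> k \<noteq> v)"

lemma indicator_avoids:
  "indicator {\<omega>. avoids v n \<omega>} \<omega> = (\<Prod>k<n. indicator (- {v}) (\<omega> k) :: ennreal)"
  by (induction n) (auto simp: avoids_def less_Suc_eq split: split_indicator_asm split_indicator)

lemma measurable_component_count_space:
  fixes g :: "'a \<Rightarrow> ennreal"
  assumes "k \<in> I"
  shows "(\<lambda>\<omega>. g (\<omega> k)) \<in> borel_measurable (PiM I (\<lambda>_. count_space UNIV))"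
  by (rule measurable_compose[OF measurable_component_singleton[OF assms]]) simp

lemma measurable_avoids:
  assumes "{..<n} \<subseteq> I"
  shows "(\<lambda>\<omega>. indicator {\<omega>. avoids v n \<omega>} \<omega> :: ennreal)
    \<in> borel_measurable (PiM I (\<lambda>_. count_space UNIV))"
  unfolding indicator_avoids
  using assms by (intro borel_measurable_prod_ennreal measurable_component_count_space) auto

lemma nn_integral_walk_first:
  fixes g :: "'a \<Rightarrow> ennreal"
  shows "(\<integral>\<^sup>+\<omega>. g (\<omega> 0) * indicator {\<omega>. avoids v 1 \<omega>} \<omega> \<partial>walk_measure G u) =
    g u * indicator (- {v}) u"
proof -
  define M where "M = (\<lambda>_::nat. count_space (UNIV :: 'a set))"
  interpret IT: Ionescu_Tulcea "walk_kernel G u" M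
    unfolding M_def by (rule Ionescu_Tulcea_walk)
  define f where "f = (\<lambda>\<omega>. g (\<omega> 0) * indicator (- {v}) (\<omega> (0::nat)))"
  have f [measurable]: "f \<in> borel_measurable (PiM {0..<Suc 0} M)"
    unfolding f_def M_def
    by (intro borel_measurable_times_ennreal measurable_component_count_space) auto
  have sp: "(\<lambda>_. undefined) \<in> space (PiM {0..<0} M)"
    by (simp add: space_PiM)
  have "(\<integral>\<^sup>+\<omega>. g (\<omega> 0) * indicator {\<omega>. avoids v 1 \<omega>} \<omega> \<partial>walk_measure G u) =
      (\<integral>\<^sup>+\<omega>. f (restrict \<omega> {0..<Suc 0}) \<partial>walk_measure G u)"
    by (intro nn_integral_cong) (auto simp: f_def avoids_def split: split_indicator)
  also have "\<dots> = (\<integral>\<^sup>+\<omega>. f \<omega> \<partial>IT.C 0 (Suc 0) (\<lambda>_. undefined))"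
    using f unfolding M_def by (rule nn_integral_walk_measure_restrict)
  also have "\<dots> = (\<integral>\<^sup>+\<omega>. f \<omega> \<partial>IT.eP 0 (\<lambda>_. undefined))"
    by (simp only: IT.C.simps bind_return[OF IT.measurable_eP sp] add_0)
  also have "\<dots> = (\<integral>\<^sup>+x. f ((\<lambda>_. undefined)(0 := x)) \<partial>walk_kernel G u 0 (\<lambda>_. undefined))"
    by (rule IT.nn_integral_eP[OF sp f])
  also have "\<dots> = g u * indicator (- {v}) u"
    by (simp add: walk_kernel_def f_def nn_integral_return)
  finally show ?thesis .
qed

text \<open>Markov property of the walk killed at \<open>v\<close>: given the positions up to time
  \<open>n\<close>, the last factor of the avoidance indicator depends only on the new position and
  moves into the one-step expectation.\<close>

lemma nn_integral_walk_Suc: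
  fixes g :: "'a \<Rightarrow> ennreal"
  shows "(\<integral>\<^sup>+\<omega>. g (\<omega> (Suc n)) * indicator {\<omega>. avoids v (Suc (Suc n)) \<omega>} \<omega> \<partial>walk_measure G u) =
    (\<integral>\<^sup>+\<omega>. (\<integral>\<^sup>+x. g x * indicator (- {v}) x \<partial>measure_pmf (pmf_of_set {w. (\<omega> n, w) \<in> parcs G}))
      * indicator {\<omega>. avoids v (Suc n) \<omega>} \<omega> \<partial>walk_measure G u)"
proof -
  define M where "M = (\<lambda>_::nat. count_space (UNIV :: 'a set))"
  interpret IT: Ionescu_Tulcea "walk_kernel G u" M
    unfolding M_def by (rule Ionescu_Tulcea_walk)
  define h where "h y = (\<integral>\<^sup>+x. g x * indicator (- {v}) x \<partial>measure_pmf (pmf_of_set {w. (y, w) \<in> parcs G}))" for y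
  define f where "f = (\<lambda>\<omega>. g (\<omega> (Suc n)) * indicator {\<omega>. avoids v (Suc (Suc n)) \<omega>} \<omega>)"
  define f' where "f' = (\<lambda>\<omega>. h (\<omega> n) * indicator {\<omega>. avoids v (Suc n) \<omega>} \<omega>)"
  have f: "f \<in> borel_measurable (PiM {0..<Suc (Suc n)} M)"
    unfolding f_def M_def
    by (intro borel_measurable_times_ennreal measurable_component_count_space measurable_avoids) auto
  have f': "f' \<in> borel_measurable (PiM {0..<Suc n} M)"
    unfolding f'_def M_def
    by (intro borel_measurable_times_ennreal measurable_component_count_space measurable_avoids) auto
  have sp: "(\<lambda>_. undefined) \<in> space (PiM {0..<0} M)"
    by (simp add: space_PiM)
  let ?C = "IT.C 0 (Suc n) (\<lambda>_. undefined)"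
  have "(\<integral>\<^sup>+\<omega>. g (\<omega> (Suc n)) * indicator {\<omega>. avoids v (Suc (Suc n)) \<omega>} \<omega> \<partial>walk_measure G u) =
      (\<integral>\<^sup>+\<omega>. f (restrict \<omega> {0..<Suc (Suc n)}) \<partial>walk_measure G u)"
    by (intro nn_integral_cong) (auto simp: f_def avoids_def split: split_indicator)
  also have "\<dots> = (\<integral>\<^sup>+\<omega>. f \<omega> \<partial>IT.C 0 (Suc (Suc n)) (\<lambda>_. undefined))"
    using f unfolding M_def by (rule nn_integral_walk_measure_restrict)
  also have "\<dots> = (\<integral>\<^sup>+\<omega>. f \<omega> \<partial>(?C \<bind> IT.eP (Suc n)))"
    by simp
  also have "\<dots> = (\<integral>\<^sup>+\<omega>. (\<integral>\<^sup>+\<omega>'. f \<omega>' \<partial>IT.eP (Suc n) \<omega>) \<partial>?C)"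
  proof (rule nn_integral_bind[OF f])
    show "IT.eP (Suc n) \<in> measurable ?C (subprob_algebra (PiM {0..<Suc (Suc n)} M))"
      using IT.measurable_eP[of "Suc n"]
      unfolding measurable_cong_sets[OF IT.sets_C[OF sp, of "Suc n"] refl] by simp
  qed
  also have "\<dots> = (\<integral>\<^sup>+\<omega>. f' \<omega> \<partial>?C)"
  proof (intro nn_integral_cong)
    fix \<omega> assume "\<omega> \<in> space ?C"
    then have \<omega>: "\<omega> \<in> space (PiM {0..<Suc n} M)"
      using IT.space_C[OF sp, of "Suc n"] by simp
    have "(\<integral>\<^sup>+\<omega>'. f \<omega>' \<partial>IT.eP (Suc n) \<omega>) = (\<integral>\<^sup>+x. f (fun_upd \<omega> (Suc n) x) \<partial>walk_kernel G u (Suc n) \<omega>)"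
      by (rule IT.nn_integral_eP[OF \<omega> f])
    also have "\<dots> = (\<integral>\<^sup>+x. g x * indicator (- {v}) x * indicator {\<omega>. avoids v (Suc n) \<omega>} \<omega>
        \<partial>walk_kernel G u (Suc n) \<omega>)"
      by (intro nn_integral_cong) (auto simp: f_def avoids_def less_Suc_eq split: split_indicator)
    also have "\<dots> = f' \<omega>"
      by (simp add: walk_kernel_def f'_def h_def nn_integral_multc)
    finally show "(\<integral>\<^sup>+\<omega>'. f \<omega>' \<partial>IT.eP (Suc n) \<omega>) = f' \<omega>" .
  qed
  also have "\<dots> = (\<integral>\<^sup>+\<omega>. f' (restrict \<omega> {0..<Suc n}) \<partial>walk_measure G u)"
    using f' unfolding M_def by (rule nn_integral_walk_measure_restrict[symmetric])
  also have "\<dots> = (\<integral>\<^sup>+\<omega>. h (\<omega> n) * indicator {\<omega>. avoids v (Suc n) \<omega>} \<omega> \<partial>walk_measure G u)"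
    by (intro nn_integral_cong) (auto simp: f'_def avoids_def split: split_indicator)
  finally show ?thesis
    by (simp add: h_def)
qed

text \<open>Tail-sum formula. It holds trajectory by trajectory, since a number N counts the n below
  N; on trajectories that miss \<open>v\<close> both sides are infinite.\<close>

lemma hitting_time_eq_suminf:
  "hitting_time G u v =
    (\<Sum>n. \<integral>\<^sup>+\<omega>. indicator {\<omega>. avoids v (Suc n) \<omega>} \<omega> \<partial>walk_measure G u)"
proof -
  have *: "(INF n\<in>{n. \<omega> n = v}. of_nat n :: ennreal) = (\<Sum>n. indicator {\<omega>. avoids v (Suc n) \<omega>} \<omega>)"
    (is "?I \<omega> = ?S \<omega>") for \<omega> :: "nat \<Rightarrow> 'a"
  proof (cases "\<exists>n. \<omega> n = v")
    case True
    define N where "N = (LEAST n. \<omega> n = v)"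
    have N: "\<omega> N = v" "\<And>k. \<omega> k = v \<Longrightarrow> N \<le> k"
      using True unfolding N_def by (auto intro: LeastI_ex Least_le)
    have "?I \<omega> \<le> of_nat N"
      using N(1) by (intro INF_lower2[of N]) auto
    moreover have "of_nat N \<le> ?I \<omega>"
      using N(2) by (intro INF_greatest) (auto simp: of_nat_le_iff)
    ultimately have "?I \<omega> = of_nat N" by (rule antisym)
    moreover have "avoids v (Suc n) \<omega> \<longleftrightarrow> n < N" for n
    proof
      show "n < N" if "avoids v (Suc n) \<omega>"
        using that N(1) unfolding avoids_def by (rule_tac ccontr) auto
      show "avoids v (Suc n) \<omega>" if "n < N"
        using that N(2) by (force simp: avoids_def)
    qed
    then have "?S \<omega> = (\<Sum>n. indicator {..<N} n)"
      by (intro suminf_cong) (auto split: split_indicator)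
    moreover have "\<dots> = (\<Sum>n<N. indicator {..<N} n)"
      by (rule suminf_finite) auto
    ultimately show ?thesis by simp
  next
    case False
    then have "?I \<omega> = top" "?S \<omega> = (\<Sum>n. 1)"
      by (auto simp: avoids_def)
    moreover have "(\<Sum>n. 1 :: ennreal) = top"
      by (simp add: suminf_eq_SUP ennreal_SUP_of_nat_eq_top)
    ultimately show ?thesis by simp
  qed
  have m: "(\<lambda>\<omega>. indicator {\<omega>. avoids v n \<omega>} \<omega> :: ennreal) \<in> borel_measurable (walk_measure G u)" for n
    using measurable_avoids[of n UNIV v] measurable_cong_sets[OF sets_walk_measure[of G u] refl] by blast
  show ?thesis
    unfolding hitting_time_def * using m by (rule nn_integral_suminf)
qed

text \<open>With \<open>S n\<close> the probability of avoiding \<open>v\<close> up to time \<open>n\<close> and \<open>R n\<close> the expectation of \<open>h\<close> at time \<open>n\<close>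
  on this event, the hypothesis reads \<open>R (n + 1) = R n - S n\<close>. So \<open>S\<close> is summable, which forces
  \<open>R n \<le> C * S n\<close> to vanish in the limit, and the sum of \<open>S\<close> is \<open>R 0 = h u\<close>.\<close>

lemma hitting_time_eqI:
  fixes G :: "'a pair_pre_digraph" and h :: "'a \<Rightarrow> real"
  defines "N \<equiv> \<lambda>x. {w. (x, w) \<in> parcs G}"
  assumes V: "finite V" and N: "\<And>x. x \<in> V \<Longrightarrow> N x \<noteq> {}" "\<And>x. x \<in> V \<Longrightarrow> N x \<subseteq> V"
    and h: "\<And>x. x \<in> V \<Longrightarrow> 0 \<le> h x" "h v = 0"
    and step: "\<And>x. x \<in> V \<Longrightarrow> x \<noteq> v \<Longrightarrow> (\<Sum>y\<in>N x. h y) / card (N x) = h x - 1"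
    and u: "u \<in> V"
  shows "hitting_time G u v = ennreal (h u)"
proof -
  \<comment> \<open>\<open>L n g\<close> is the expectation of \<open>g\<close> at time
    \<open>n\<close> for the walk killed at \<open>v\<close>, and \<open>P\<close> is its transition
    operator. The \<open>S n\<close> and \<open>R n\<close> above are
    \<open>L n (\<lambda>_. 1)\<close> and \<open>L n H\<close>, with \<open>H\<close> the function
    \<open>h\<close> in \<open>ennreal\<close>.\<close>
  define L where "L n g = (\<integral>\<^sup>+\<omega>. g (\<omega> n) * indicator {\<omega>. avoids v (Suc n) \<omega>} \<omega> \<partial>walk_measure G u)"
    for n and g :: "'a \<Rightarrow> ennreal"
  define P where "P g x = (\<integral>\<^sup>+y. g y * indicator (- {v}) y \<partial>measure_pmf (pmf_of_set (N x)))"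
    for x and g :: "'a \<Rightarrow> ennreal"
  have L_0: "L 0 g = g u * indicator (- {v}) u" for g
    unfolding L_def using nn_integral_walk_first[where g = g and v = v and G = G and u = u] by simp
  have L_Suc: "L (Suc n) g = L n (P g)" for n g
    unfolding L_def P_def N_def by (rule nn_integral_walk_Suc)
  have P: "P g x = (\<Sum>y\<in>N x. g y * indicator (- {v}) y) / card (N x)" if "x \<in> V" for g x
    unfolding P_def using N[OF that] finite_subset[OF _ V]
    by (subst nn_integral_pmf_of_set) auto
  have m: "(\<lambda>\<omega>. g (\<omega> n) * indicator {\<omega>. avoids v (Suc n) \<omega>} \<omega>) \<in> borel_measurable (walk_measure G u)"
    for n and g :: "'a \<Rightarrow> ennreal"
    using measurable_cong_sets[OF sets_walk_measure[of G u] refl]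
    by (intro borel_measurable_times_ennreal)
       (auto intro: measurable_component_count_space measurable_avoids)
  \<comment> \<open>The walk almost surely stays in \<open>V\<close>. The function is generalized in
    the induction because a step trades \<open>g\<close> for \<open>P g\<close>.\<close>
  have L_null: "L n g = 0" if "\<And>x. x \<in> V \<Longrightarrow> g x = 0" for n g
    using that
  proof (induction n arbitrary: g)
    case 0
    then show ?case using u by (simp add: L_0)
  next
    case (Suc n)
    have "P g x = 0" if "x \<in> V" for x
      using Suc.prems N(2)[OF that] by (subst P[OF that]) (auto simp: subset_eq)
    then show ?case
      unfolding L_Suc by (rule Suc.IH)
  qed
  have L_cong: "L n g = L n g'" if "\<And>x. x \<in> V \<Longrightarrow> x \<noteq> v \<Longrightarrow> g x = g' x" for n g g'
  proof -
    have "L n (indicator (- V)) = 0"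
      by (rule L_null) auto
    then have "AE \<omega> in walk_measure G u. indicator (- V) (\<omega> n) *
        indicator {\<omega>. avoids v (Suc n) \<omega>} \<omega> = (0 :: ennreal)"
      unfolding L_def using m by (subst (asm) nn_integral_0_iff_AE) auto
    then show ?thesis
      unfolding L_def using that
      by (intro nn_integral_cong_AE, elim AE_mp)
         (auto intro!: AE_I2 simp: avoids_def split: split_indicator split_indicator_asm)
  qed
  have L_add: "L n (\<lambda>x. g x + g' x) = L n g + L n g'" for n g g'
    unfolding L_def distrib_right by (rule nn_integral_add) (rule m)+
  define H where "H = (\<lambda>x. ennreal (h x))"
  \<comment> \<open>Stated additively because subtraction in \<open>ennreal\<close> is
    truncated.\<close>
  have L_step: "L (Suc n) H + L n (\<lambda>_. 1) = L n H" for n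
  proof -
    have "P H x + 1 = H x" if x: "x \<in> V" "x \<noteq> v" for x
    proof -
      have fin: "finite (N x)" and card: "card (N x) > 0"
        using N[OF x(1)] finite_subset[OF _ V] by (auto simp: card_gt_0_iff)
      have nonneg: "(\<Sum>y\<in>N x. h y) \<ge> 0"
        using N(2)[OF x(1)] h by (intro sum_nonneg) auto
      \<comment> \<open>Killing at \<open>v\<close> loses nothing, as
        \<open>h v = 0\<close>.\<close>
      have "(\<Sum>y\<in>N x. H y * indicator (- {v}) y) = (\<Sum>y\<in>N x. ennreal (h y))"
        using h(2) by (intro sum.cong) (auto simp: H_def split: split_indicator)
      also have "\<dots> = ennreal (\<Sum>y\<in>N x. h y)"
        using N(2)[OF x(1)] h by (intro sum_ennreal) auto
      finally have "P H x = ennreal ((\<Sum>y\<in>N x. h y) / card (N x))"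
        using nonneg card by (simp add: P[OF x(1)] divide_ennreal ennreal_of_nat_eq_real_of_nat)
      moreover have "0 \<le> (\<Sum>y\<in>N x. h y) / card (N x)"
        using nonneg by simp
      ultimately show ?thesis
        unfolding step[OF x] H_def by (simp add: ennreal_plus[symmetric] del: ennreal_plus flip: ennreal_1)
    qed
    then have "L n H = L n (\<lambda>x. P H x + 1)"
      by (intro L_cong) auto
    then show ?thesis
      by (simp add: L_add L_Suc)
  qed
  have L_sum: "(\<Sum>k<n. L k (\<lambda>_. 1)) + L n H = ennreal (h u)" for n
  proof (induction n)
    case 0
    then show ?case using h(2) by (auto simp: L_0 H_def split: split_indicator)
  next
    case (Suc n)
    have "(\<Sum>k<Suc n. L k (\<lambda>_. 1)) + L (Suc n) H = (\<Sum>k<n. L k (\<lambda>_. 1)) + L n H"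
      by (simp add: L_step[of n, symmetric] ac_simps)
    then show ?case using Suc.IH by simp
  qed
  define C where "C = (\<Sum>x\<in>V. h x)"
  have C: "C \<ge> 0" "\<And>x. x \<in> V \<Longrightarrow> h x \<le> C"
    unfolding C_def using V h by (auto intro: sum_nonneg member_le_sum)
  have L_le: "L n H \<le> ennreal C * L n (\<lambda>_. 1)" for n
  proof -
    \<comment> \<open>Only values on \<open>V\<close> count, so truncation at \<open>C\<close>
      leaves the expectation unchanged; it makes the bound valid at every point, also outside
      \<open>V\<close>, where \<open>h\<close> is unconstrained.\<close>
    have "L n H = L n (\<lambda>x. min (H x) (ennreal C))"
      using C by (intro L_cong) (auto simp: H_def min_def ennreal_leI)
    also have "\<dots> \<le> L n (\<lambda>_. ennreal C)"
      unfolding L_def by (intro nn_integral_mono mult_right_mono) auto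
    also have "\<dots> = ennreal C * L n (\<lambda>_. 1)"
      using nn_integral_cmult[OF m[of "\<lambda>_. 1" n], of "ennreal C"] by (simp add: L_def)
    finally show ?thesis .
  qed
  \<comment> \<open>All expectations are bounded by \<open>h u\<close>; passing to real numbers
    permits subtraction in the telescoped identity \<open>L_sum\<close>.\<close>
  define l where "l n = enn2real (L n (\<lambda>_. 1))" for n
  define r where "r n = enn2real (L n H)" for n
  have L_le_h: "L n (\<lambda>_. 1) \<le> ennreal (h u)" "L n H \<le> ennreal (h u)" for n
  proof -
    show "L n H \<le> ennreal (h u)"
      using L_sum[of n] by (metis add_increasing zero_le order_refl)
    show "L n (\<lambda>_. 1) \<le> ennreal (h u)"
      using L_sum[of "Suc n"] by (simp add: ac_simps) (metis le_iff_add)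
  qed
  have fin: "L n (\<lambda>_. 1) < top" "L n H < top" for n
    using L_le_h[of n] by (auto intro: le_less_trans simp: ennreal_less_top)
  have l: "L n (\<lambda>_. 1) = ennreal (l n)" "0 \<le> l n" and r: "L n H = ennreal (r n)" "0 \<le> r n" for n
    using fin[of n] by (auto simp: l_def r_def)
  have sum_l: "(\<Sum>k<n. l k) + r n = h u" for n
  proof -
    have "ennreal ((\<Sum>k<n. l k) + r n) = ennreal (h u)"
      using L_sum[of n] l r by (simp add: sum_nonneg)
    then show ?thesis
      using l r h(1)[OF u] by (subst (asm) ennreal_inj) (auto intro!: add_nonneg_nonneg sum_nonneg)
  qed
  have r_le: "r n \<le> C * l n" for n
    using L_le[of n] C(1) l r by (simp add: ennreal_mult[symmetric])
  have "(\<Sum>k<n. l k) \<le> h u" for n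
    using sum_l[of n] r(2)[of n] by linarith
  then have "summable l"
    using l(2) by (intro summableI_nonneg_bounded[of _ "h u"]) auto
  then have "l \<longlonglongrightarrow> 0"
    by (rule summable_LIMSEQ_zero)
  then have "(\<lambda>n. C * l n) \<longlonglongrightarrow> 0"
    by (rule tendsto_mult_right_zero)
  then have "r \<longlonglongrightarrow> 0"
    using r r_le by (intro tendsto_sandwich[of "\<lambda>_. 0" r sequentially "\<lambda>n. C * l n"]) auto
  then have "(\<lambda>n. h u - r n) \<longlonglongrightarrow> h u - 0"
    by (intro tendsto_intros)
  moreover have "h u - r n = (\<Sum>k<n. l k)" for n
    using sum_l[of n] by simp
  ultimately have "l sums h u"
    by (simp add: sums_def)
  then have "(\<Sum>n. ennreal (l n)) = ennreal (h u)"
    using l by (intro suminf_ennreal_eq) auto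
  then show ?thesis
    unfolding hitting_time_eq_suminf using l(1) by (simp add: L_def)
qed

section \<open>Mean hitting time and Wiener index\<close>

context metric_tree
begin

lemma dist_triangle:
  assumes "u \<in> pverts G" "v \<in> pverts G" "z \<in> pverts G"
  shows "d u z \<le> d u v + d v z"
proof -
  obtain p q where "awalk u p v" "length p = d u v" "awalk v q z" "length q = d v z"
    using awalk_dist_ex assms by meson
  then show ?thesis
    using awalk_dist_le[of u "p @ q" z] awalk_appendI[of u p v q z] by simp
qed

lemma hit_nonneg:
  assumes "u \<in> pverts G" "v \<in> pverts G"
  shows "0 \<le> hit v u"
proof -
  have "real (d u z) \<le> real (d u v) + d v z" if "z \<in> pverts G" for z
    using dist_triangle[OF assms that] by linarith
  then show ?thesis
    by (auto simp: hit_def intro!: sum_nonneg)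
qed

lemma wiener_index_nonneg: "0 \<le> wiener_index G"
proof -
  have "0 \<le> 2 * wiener_index G"
    unfolding wiener_index_eq by (intro sum_nonneg) auto
  then show ?thesis by simp
qed

lemma hitting_time_eq:
  assumes V: "u \<in> pverts G" "v \<in> pverts G" and card: "card (pverts G) \<ge> 2"
  shows "hitting_time G u v = ennreal (hit v u)"
proof (rule hitting_time_eqI[where V = "pverts G"])
  \<comment> \<open>A second vertex rules out isolated vertices, at which the uniform distribution
    on the neighbours would be unspecified.\<close>
  have "\<exists>y\<in>pverts G. y \<noteq> x" for x
  proof (rule ccontr)
    assume "\<not> (\<exists>y\<in>pverts G. y \<noteq> x)"
    then have "card (pverts G) \<le> card {x}"
      by (intro card_mono) auto
    with card show False by simp
  qed
  then show "{w. (x, w) \<in> parcs G} \<noteq> {}" if "x \<in> pverts G" for x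
    using parent_ex[OF that] by blast
qed (use V hit_step hit_nonneg in \<open>auto simp: pair_finite_verts hit_self nbrs_def deg_def dest: in_arcsD2\<close>)

lemma mean_hitting_time_eq:
  assumes card: "card (pverts G) \<ge> 2"
  shows "mean_hitting_time G = ennreal (2 * wiener_index G / card (pverts G))"
proof -
  let ?n = "card (pverts G)"
  have ne: "pverts G \<noteq> {}" using card by auto
  have "(\<Sum>u\<in>pverts G. \<Sum>v\<in>pverts G. hitting_time G u v) =
      (\<Sum>u\<in>pverts G. \<Sum>v\<in>pverts G. ennreal (hit v u))"
    by (intro sum.cong refl hitting_time_eq card)
  also have "\<dots> = (\<Sum>u\<in>pverts G. ennreal (\<Sum>v\<in>pverts G. hit v u))"
    using hit_nonneg by (intro sum.cong refl sum_ennreal) auto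
  also have "\<dots> = ennreal (\<Sum>u\<in>pverts G. \<Sum>v\<in>pverts G. hit v u)"
    using hit_nonneg by (intro sum_ennreal sum_nonneg) auto
  also have "\<dots> = ennreal (2 * (nv - 1) * wiener_index G)"
    by (simp add: sum_hit[OF ne])
  finally have "mean_hitting_time G = ennreal (2 * (nv - 1) * wiener_index G / (?n * (?n - 1)))"
    using card wiener_index_nonneg by (simp add: mean_hitting_time_def ennreal_of_nat_eq_real_of_nat divide_ennreal of_nat_diff)
  also have "2 * (nv - 1) * wiener_index G / (?n * (?n - 1)) = 2 * wiener_index G / ?n"
  proof -
    have "2 * (x - 1) * w / (x * (x - 1)) = 2 * w / x" if "x - 1 \<noteq> 0" for x w :: real
      using that by (auto simp: divide_simps algebra_simps)
    from this[of nv "wiener_index G"] show ?thesis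
      using card by (simp add: of_nat_diff)
  qed
  finally show ?thesis .
qed

end

section \<open>Finite trees\<close>

lemma relpow_sym:
  assumes "sym R" "(x, y) \<in> R ^^ n"
  shows "(y, x) \<in> R ^^ n"
  using assms(2)
proof (induction n arbitrary: x)
  case (Suc n)
  then obtain z where "(x, z) \<in> R" "(z, y) \<in> R ^^ n"
    by (meson relpow_Suc_E2)
  then show ?case
    using Suc.IH assms(1) by (auto dest: symD)
qed auto

text \<open>A bridge from vertex lists, where repetitions can be removed by
  \<open>rtrancl_path_distinct\<close>, to arc walks, in terms of which cycles are defined.\<close>

lemma (in pair_wf_digraph) rtrancl_path_awalk:
  assumes "rtrancl_path (\<lambda>x y. (x, y) \<in> parcs G) x xs y" "x \<in> pverts G"
  shows "\<exists>p. awalk x p y \<and> pawalk_verts x p = x # xs"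
  using assms
proof (induction rule: rtrancl_path.induct)
  case (base x)
  then show ?case by (auto simp: awalk_Nil_iff intro!: exI[of _ "[]"])
next
  case (step x y ys z)
  then obtain p where "awalk y p z" "pawalk_verts y p = y # ys"
    by (auto dest: in_arcsD2)
  then show ?case
    using step.hyps by (intro exI[of _ "(x, y) # p"]) (auto simp: awalk_Cons_iff)
qed

text \<open>Otherwise a repetition-free walk from \<open>y\<close> to \<open>y'\<close> that misses
  \<open>x\<close> closes up through \<open>x\<close> to a cycle. It has at least one arc, and the
  two arcs at \<open>x\<close> bring the length to at least 3.\<close>

lemma finite_tree_avoiding_walk:
  fixes G :: "'a pair_pre_digraph"
  assumes T: "finite_tree G" and y: "(x, y) \<in> parcs G" "(x, y') \<in> parcs G"
    and walk: "(\<lambda>a b. (a, b) \<in> parcs G \<and> a \<noteq> x \<and> b \<noteq> x)\<^sup>*\<^sup>* y y'"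
  shows "y = y'"
proof (rule ccontr)
  assume ne: "y \<noteq> y'"
  interpret pair_graph G
    using T by (simp add: finite_tree_def)
  obtain xs where xs: "rtrancl_path (\<lambda>a b. (a, b) \<in> parcs G \<and> a \<noteq> x \<and> b \<noteq> x) y xs y'" "distinct (y # xs)"
    using walk unfolding rtranclp_eq_rtrancl_path by (meson rtrancl_path_distinct)
  have "x \<notin> set xs \<and> rtrancl_path (\<lambda>a b. (a, b) \<in> parcs G) y xs y'"
    using xs(1) by induction (auto intro: rtrancl_path.intros)
  moreover have "y \<in> pverts G" "y' \<in> pverts G" "x \<noteq> y"
    using y no_loops' by (auto dest: in_arcsD2)
  ultimately obtain p where p: "awalk y p y'" "pawalk_verts y p = y # xs" "x \<notin> set (y # xs)"
    using rtrancl_path_awalk[of y xs y'] by auto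
  have "p \<noteq> []" using ne p by (auto simp: awalk_Nil_iff)
  define c where "c = (x, y) # p @ [(y', x)]"
  have "awalk x c x"
    using awalk_appendI[OF p(1), of "[(y', x)]" x] y arcs_symmetric[of x y']
    unfolding c_def awalk_Cons_iff by (auto simp: awalk_simps dest: in_arcsD1)
  moreover have "pcas y p y' \<Longrightarrow> pawalk_verts y (p @ [(y', x)]) = pawalk_verts y p @ [x]"
    by (induction p arbitrary: y) auto
  then have "pawalk_verts x c = x # pawalk_verts y p @ [x]"
    using p(1) by (auto simp: c_def awalk_def)
  then have "distinct (tl (pawalk_verts x c))"
    using p xs(2) by auto
  moreover have "c \<noteq> []" "3 \<le> length c"
    using \<open>p \<noteq> []\<close> by (cases p; simp add: c_def)+
  ultimately have "cycle c \<and> 3 \<le> length c"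
    by (auto simp: cycle_def)
  with T show False
    by (auto simp: finite_tree_def)
qed

text \<open>If a neighbour \<open>w\<close> of \<open>u\<close> other than the parent were no
  farther from \<open>a\<close> than \<open>u\<close>, shortest walks from both to \<open>a\<close>
  would miss \<open>u\<close>. Joined at \<open>a\<close>, they contradict
  \<open>finite_tree_avoiding_walk\<close>.\<close>

lemma finite_tree_metric_tree:
  fixes G :: "'a pair_pre_digraph"
  assumes T: "finite_tree G"
  shows "metric_tree G (\<lambda>u v. LEAST n. (u, v) \<in> parcs G ^^ n)"
proof -
  interpret pair_graph G
    using T by (simp add: finite_tree_def)
  let ?E = "parcs G"
  have sym: "sym ?E"
    by (auto intro: symI arcs_symmetric)
  define d where "d u v = (LEAST n. (u, v) \<in> ?E ^^ n)" for u v
  have d_le: "(u, v) \<in> ?E ^^ n \<Longrightarrow> d u v \<le> n" for u v n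
    unfolding d_def by (rule Least_le)
  have reach: "(u, v) \<in> ?E ^^ d u v" if "u \<in> pverts G" "v \<in> pverts G" for u v
  proof -
    have "strongly_connected (with_proj (mk_symmetric (with_proj G)))"
      using T by (simp add: finite_tree_def connected_def)
    then have "reachable (with_proj (mk_symmetric (with_proj G))) u v"
      using that by (auto simp: strongly_connected_def)
    then have "(u, v) \<in> ?E\<^sup>*"
      unfolding reachable_def
      by (auto dest!: rtrancl_on_rtranclI simp: adj_mk_symmetric_eq[OF pair_sym_arcs])
    then show ?thesis
      unfolding d_def by (auto dest: rtrancl_imp_relpow intro: LeastI)
  qed
  have dist_step: "d u a \<le> Suc (d w a)" if "(u, w) \<in> ?E" "a \<in> pverts G" for u w a
    using reach[of w a] that by (intro d_le) (auto intro: relpow_Suc_I2 dest: in_arcsD2 simp del: relpow.simps)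
  have parent: "\<exists>p. (u, p) \<in> ?E \<and> d u a = Suc (d p a)"
    if ua: "u \<in> pverts G" "a \<in> pverts G" "u \<noteq> a" for u a
  proof -
    have "d u a \<noteq> 0"
      using reach[OF ua(1,2)] ua(3) by (metis relpow_0_E)
    then obtain n where n: "d u a = Suc n"
      using not0_implies_Suc by blast
    then obtain p where p: "(u, p) \<in> ?E" "(p, a) \<in> ?E ^^ n"
      using reach[OF ua(1,2)] by (metis relpow_Suc_E2)
    then show ?thesis
      using d_le[OF p(2)] dist_step[OF p(1) ua(2)] n by (intro exI[of _ p]) auto
  qed
  \<comment> \<open>A walk along parents has distances below \<open>d x a\<close> after its first
    vertex, so it could meet \<open>x\<close> only at its start.\<close>
  have avoid: "(\<lambda>b c. (b, c) \<in> ?E \<and> b \<noteq> x \<and> c \<noteq> x)\<^sup>*\<^sup>* y a"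
    if "y \<in> pverts G" "a \<in> pverts G" "d y a \<le> d x a" "y \<noteq> x" for x y a
    using that
  proof (induction "d y a" arbitrary: y rule: less_induct)
    case less
    show ?case
    proof (cases "y = a")
      case False
      then obtain p where p: "(y, p) \<in> ?E" "d y a = Suc (d p a)"
        using parent less.prems by blast
      then have px: "p \<noteq> x" using less.prems by auto
      then have "(\<lambda>b c. (b, c) \<in> ?E \<and> b \<noteq> x \<and> c \<noteq> x)\<^sup>*\<^sup>* p a"
        using p less.prems by (intro less.hyps) (auto dest: in_arcsD2)
      with px p(1) less.prems(4) show ?thesis
        by (auto intro: converse_rtranclp_into_rtranclp)
    qed auto
  qed
  show ?thesis
    unfolding d_def[symmetric]
  proof unfold_locales
    show "d u u = 0" for u
      using d_le[of u u 0] by simp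
    \<comment> \<open>This covers pairs that are not joined by a walk: both \<open>LEAST\<close>
      terms have the same predicate, even if nothing satisfies it.\<close>
    show "d u v = d v u" for u v
      unfolding d_def using relpow_sym[OF sym] by meson
  next
    fix u a assume u: "u \<in> pverts G" "a \<in> pverts G" "u \<noteq> a"
    obtain p where p: "(u, p) \<in> ?E" "d u a = Suc (d p a)"
      using parent[OF u] by blast
    have "d w a = Suc (d u a)" if w: "(u, w) \<in> ?E" "w \<noteq> p" for w
    proof (rule ccontr)
      assume "d w a \<noteq> Suc (d u a)"
      moreover have "d w a \<le> Suc (d u a)"
        using dist_step[of w u a] w arcs_symmetric u by blast
      ultimately have "d w a \<le> d u a" by simp
      have E: "w \<in> pverts G" "p \<in> pverts G" using w p by (auto dest: in_arcsD2)
      let ?R = "\<lambda>b c. (b, c) \<in> ?E \<and> b \<noteq> u \<and> c \<noteq> u"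
      have "?R\<^sup>*\<^sup>* w a" "?R\<^sup>*\<^sup>* p a"
        using E \<open>d w a \<le> d u a\<close> p w(1) u no_loops'[of u w] no_loops'[of u p] by (auto intro!: avoid)
      moreover have "symp ?R"
        by (auto intro: sympI arcs_symmetric)
      ultimately have "?R\<^sup>*\<^sup>* w p"
        by (meson rtranclp_trans sympD symp_rtranclp)
      then have "w = p"
        by (rule finite_tree_avoiding_walk[OF T w(1) p(1)])
      with w(2) show False by simp
    qed
    with p show "\<exists>p. (u, p) \<in> ?E \<and> d u a = Suc (d p a) \<and> (\<forall>w. (u, w) \<in> ?E \<longrightarrow> w \<noteq> p \<longrightarrow> d w a = Suc (d u a))"
      by blast
  qed
qed

section \<open>Attaching leaves\<close>

locale leaf_extension = metric_tree G d for G :: "'a pair_pre_digraph" and d +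
  fixes H :: "'a pair_pre_digraph" and L :: "'a set" and p :: "'a \<Rightarrow> 'a"
  assumes finite_L: "finite L"
    and disjoint: "L \<inter> pverts G = {}"
    and p_in: "p ` L \<subseteq> pverts G"
    and card_leaves: "v \<in> pverts G \<Longrightarrow> card {w \<in> L. p w = v} = 2 * deg v"
    and verts_H: "pverts H = pverts G \<union> L"
    and arcs_H: "parcs H = parcs G \<union> {(w, p w) |w. w \<in> L} \<union> {(p w, w) |w. w \<in> L}"
begin

definition base :: "'a \<Rightarrow> 'a" where
  "base x = (if x \<in> L then p x else x)"

definition height :: "'a \<Rightarrow> nat" where
  "height x = (if x \<in> L then 1 else 0)"

text \<open>The general formula gives 2 for two leaves at the same vertex, as it should, but also
  for a leaf and itself; hence the separate case \<open>x = a\<close>.\<close>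

definition ext_dist :: "'a \<Rightarrow> 'a \<Rightarrow> nat" where
  "ext_dist x a = (if x = a then 0 else d (base x) (base a) + height x + height a)"

lemma in_L:
  assumes "w \<in> L"
  shows "w \<notin> pverts G" "p w \<in> pverts G" "p w \<noteq> w" "p w \<notin> L" "(w, y) \<notin> parcs G" "(y, w) \<notin> parcs G"
proof -
  show w: "w \<notin> pverts G" "p w \<in> pverts G"
    using assms disjoint p_in by auto
  then show "p w \<noteq> w" by metis
  show "p w \<notin> L" using w(2) disjoint by auto
  show "(w, y) \<notin> parcs G" "(y, w) \<notin> parcs G"
    using w(1) by (auto dest: in_arcsD1 in_arcsD2)
qed

text \<open>A leaf has its attachment vertex as parent. An old vertex \<open>x\<close> keeps its
  parent towards \<open>base a\<close>, unless \<open>a\<close> is a leaf attached to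
  \<open>x\<close>; then the parent is \<open>a\<close> itself.\<close>

lemma ext_dist_parent:
  assumes "x \<in> pverts H" "a \<in> pverts H" "x \<noteq> a"
  shows "\<exists>q. (x, q) \<in> parcs H \<and> ext_dist x a = Suc (ext_dist q a) \<and>
          (\<forall>w. (x, w) \<in> parcs H \<longrightarrow> w \<noteq> q \<longrightarrow> ext_dist w a = Suc (ext_dist x a))"
proof (cases "x \<in> L")
  case True
  then show ?thesis
    using assms(3) True in_L[of a] in_L[OF True] in_L(4)
    by (intro exI[of _ "p x"]) (auto simp: arcs_H ext_dist_def base_def height_def)
next
  case False
  then have x: "x \<in> pverts G" using assms(1) by (auto simp: verts_H)
  have nbr: "w \<in> pverts G \<and> w \<notin> L \<and> w \<noteq> x \<and> d w x = 1" if "(x, w) \<in> parcs G" for w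
  proof (intro conjI)
    show w: "w \<in> pverts G" using that by (rule in_arcsD2)
    then show "w \<notin> L" using disjoint by blast
    show "w \<noteq> x" using no_loops'[OF that] by metis
    show "d w x = 1" using that by (intro dist_nbr) (simp add: nbrs_def)
  qed
  have arcs_x: "(x, w) \<in> parcs H \<longleftrightarrow> (x, w) \<in> parcs G \<or> w \<in> L \<and> p w = x" for w
    using False by (auto simp: arcs_H)
  have base_x: "base x = x" "height x = 0"
    using False by (auto simp: base_def height_def)
  have ext_G: "ext_dist w a = d w (base a) + height a" if "w \<in> pverts G" "w \<noteq> a" for w
    using that disjoint by (auto simp: ext_dist_def base_def height_def)
  have ext_L: "ext_dist w a = Suc (d x (base a) + height a)" if "w \<in> L" "p w = x" "w \<noteq> a" for w
    using that by (simp add: ext_dist_def base_def height_def)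
  have ext_x: "ext_dist x a = d x (base a) + height a"
    using ext_G[OF x assms(3)] .
  show ?thesis
  proof (cases "a \<in> L \<and> p a = x")
    case True
    then have a: "base a = x" "height a = 1" "(x, a) \<in> parcs H"
      by (auto simp: base_def height_def arcs_x)
    have "ext_dist w a = 2" if "(x, w) \<in> parcs H" "w \<noteq> a" for w
      using that(1) ext_G[OF _ that(2)] ext_L[OF _ _ that(2)] nbr[of w] unfolding arcs_x a by auto
    then show ?thesis
      using a(3) by (intro exI[of _ a]) (simp add: ext_x a ext_dist_def[of a])
  next
    case ne: False
    have ba: "base a \<in> pverts G" "x \<noteq> base a"
      using assms(2,3) ne p_in by (auto simp: base_def verts_H)
    obtain q where q: "(x, q) \<in> parcs G" "d x (base a) = Suc (d q (base a))"
      "\<And>w. (x, w) \<in> parcs G \<Longrightarrow> w \<noteq> q \<Longrightarrow> d w (base a) = Suc (d x (base a))"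
      using parent_ex[OF x ba] by blast
    have ext: "ext_dist w a = d w (base a) + height a" if "w \<in> pverts G" for w
      using ext_G[OF that] that disjoint by (cases "w = a") (auto simp: ext_dist_def base_def height_def)
    have "ext_dist w a = Suc (ext_dist x a)" if w: "(x, w) \<in> parcs H" "w \<noteq> q" for w
      using w(1) unfolding arcs_x
    proof
      assume "(x, w) \<in> parcs G"
      then show ?thesis
        using ext[of w] nbr[of w] q(3)[of w] w(2) by (simp add: ext_x)
    next
      assume "w \<in> L \<and> p w = x"
      then show ?thesis
        using ext_L[of w] ne by (auto simp: ext_x)
    qed
    moreover have "ext_dist x a = Suc (ext_dist q a)"
      using ext[of q] nbr[OF q(1)] q(2) by (simp add: ext_x)
    ultimately show ?thesis
      using q(1) by (intro exI[of _ q]) (simp add: arcs_x)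
  qed
qed

lemma ext_metric_tree: "metric_tree H ext_dist"
proof unfold_locales
  fix e assume e: "e \<in> parcs H"
  show "fst e \<in> pverts H" "snd e \<in> pverts H"
    using e in_L by (auto simp: arcs_H verts_H dest: in_arcsD1 in_arcsD2)
  show "fst e \<noteq> snd e"
    using e in_L(3) in_L(3)[THEN not_sym] no_loops by (auto simp: arcs_H)
next
  show "finite (pverts H)"
    by (simp add: verts_H finite_L pair_finite_verts)
  have "{(w, p w) |w. w \<in> L} = (\<lambda>w. (w, p w)) ` L" "{(p w, w) |w. w \<in> L} = (\<lambda>w. (p w, w)) ` L"
    by auto
  then show "finite (parcs H)"
    by (simp add: arcs_H finite_L pair_finite_arcs)
  show "symmetric (with_proj H)"
    by (auto simp: symmetric_def arcs_H intro!: symI dest: arcs_symmetric)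
  show "ext_dist u u = 0" for u
    by (simp add: ext_dist_def)
  show "ext_dist u v = ext_dist v u" for u v
    by (simp add: ext_dist_def dist_sym[of "base u"])
qed (rule ext_dist_parent)

lemma sum_leaves:
  fixes f :: "'a \<Rightarrow> real"
  shows "(\<Sum>w\<in>L. f (p w)) = (\<Sum>v\<in>pverts G. 2 * deg v * f v)"
proof -
  have "(\<Sum>w\<in>L. f (p w)) = (\<Sum>v\<in>pverts G. \<Sum>w\<in>{w \<in> L. p w = v}. f (p w))"
    by (rule sum.group[symmetric]) (simp_all add: finite_L pair_finite_verts p_in)
  also have "\<dots> = (\<Sum>v\<in>pverts G. \<Sum>w\<in>{w \<in> L. p w = v}. f v)"
    by (intro sum.cong) auto
  finally show ?thesis
    by (simp add: card_leaves)
qed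

text \<open>The fibre of \<open>base\<close> over \<open>v\<close> consists of \<open>v\<close> and
  its \<open>2 * deg v\<close> leaves.\<close>

lemma sum_base:
  fixes f :: "'a \<Rightarrow> real"
  shows "(\<Sum>x\<in>pverts H. f (base x)) = (\<Sum>v\<in>pverts G. (1 + 2 * deg v) * f v)"
proof -
  have "(\<Sum>x\<in>pverts H. f (base x)) = (\<Sum>x\<in>pverts G. f (base x)) + (\<Sum>x\<in>L. f (base x))"
    unfolding verts_H using finite_L pair_finite_verts disjoint by (intro sum.union_disjoint) auto
  also have "(\<Sum>x\<in>pverts G. f (base x)) = (\<Sum>x\<in>pverts G. f x)"
    using disjoint by (intro sum.cong) (auto simp: base_def)
  also have "(\<Sum>x\<in>L. f (base x)) = (\<Sum>x\<in>L. f (p x))"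
    by (intro sum.cong) (auto simp: base_def)
  finally show ?thesis
    by (simp add: sum_leaves sum.distrib[symmetric] ring_distribs)
qed

lemma sum_height:
  assumes "pverts G \<noteq> {}"
  shows "(\<Sum>x\<in>pverts H. real (height x)) = 4 * (nv - 1)"
proof -
  have "(\<Sum>x\<in>pverts H. real (height x)) = (\<Sum>x\<in>L. 1)"
    using finite_L pair_finite_verts disjoint
    by (intro sum.mono_neutral_cong_right) (auto simp: verts_H height_def)
  also have "\<dots> = 4 * (nv - 1)"
    using sum_leaves[of "\<lambda>_. 1"] by (simp add: sum_deg[OF assms] sum_distrib_left[symmetric])
  finally show ?thesis .
qed

lemma card_pverts_extension:
  assumes "pverts G \<noteq> {}"
  shows "real (card (pverts H)) - 1 = 5 * (nv - 1)"
  using sum_base[of "\<lambda>_. 1"]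
  by (simp add: sum.distrib sum_distrib_left[symmetric] sum_deg[OF assms])

text \<open>Sums over \<open>H\<close> become sums over \<open>G\<close> with weight
  \<open>1 + 2 * deg\<close>. By \<open>sum_deg_dist\<close> a degree weight doubles a sum of
  distances up to a term in \<open>m\<close>, so each of the two variables gives a factor 1 + 2 * 2
  = 5.\<close>

lemma wiener_index_extension:
  assumes ne: "pverts G \<noteq> {}"
  shows "wiener_index H = 25 * wiener_index G + 10 * (nv - 1)\<^sup>2 - 6 * (nv - 1)"
proof -
  interpret H: metric_tree H ext_dist
    by (rule ext_metric_tree)
  let ?V = "pverts G" and ?m = "nv - 1"
  define S where "S v = (\<Sum>u\<in>?V. real (d u v))" for v
  have n': "real (card (pverts H)) = nv + 4 * ?m"
    using card_pverts_extension[OF ne] by simp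
  have S: "(\<Sum>v\<in>?V. S v) = 2 * wiener_index G"
    unfolding wiener_index_eq S_def by (rule sum.swap)
  have "(\<Sum>v\<in>?V. deg v * S v) = (\<Sum>u\<in>?V. \<Sum>v\<in>?V. deg v * real (d v u))"
    unfolding S_def sum_distrib_left by (subst sum.swap) (simp add: dist_sym)
  also have "\<dots> = (\<Sum>u\<in>?V. 2 * S u - ?m)"
    by (intro sum.cong refl) (simp add: sum_deg_dist S_def)
  finally have kS: "(\<Sum>v\<in>?V. deg v * S v) = 4 * wiener_index G - nv * ?m"
    by (simp add: sum_subtractf sum_distrib_left[symmetric] S)
  \<comment> \<open>The last term corrects the diagonal, where the general distance formula yields
    \<open>2 * height x\<close> instead of 0.\<close>
  have "2 * wiener_index H = (\<Sum>x\<in>pverts H. \<Sum>a\<in>pverts H.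
      real (d (base x) (base a)) + height x + height a - (if a = x then 2 * real (height x) else 0))"
    unfolding H.wiener_index_eq by (intro sum.cong refl) (simp add: ext_dist_def)
  also have "\<dots> = (\<Sum>x\<in>pverts H. \<Sum>a\<in>pverts H. real (d (base x) (base a)))
      + 2 * real (card (pverts H)) * (\<Sum>x\<in>pverts H. real (height x)) - 2 * (\<Sum>x\<in>pverts H. real (height x))"
    by (simp add: sum.distrib sum_subtractf H.pair_finite_verts sum_distrib_left[symmetric])
  also have "(\<Sum>x\<in>pverts H. \<Sum>a\<in>pverts H. real (d (base x) (base a))) =
      (\<Sum>a\<in>pverts H. \<Sum>x\<in>pverts H. real (d (base x) (base a)))"
    by (rule sum.swap)
  also have "\<dots> = (\<Sum>a\<in>pverts H. \<Sum>u\<in>?V. (1 + 2 * deg u) * real (d u (base a)))"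
    by (intro sum.cong[OF refl] sum_base)
  also have "\<dots> = (\<Sum>v\<in>?V. (1 + 2 * deg v) * (\<Sum>u\<in>?V. (1 + 2 * deg u) * real (d u v)))"
    by (rule sum_base)
  also have "\<dots> = (\<Sum>v\<in>?V. (1 + 2 * deg v) * (5 * S v - 2 * ?m))"
  proof (intro sum.cong refl arg_cong2[where f = "(*)"])
    fix v assume v: "v \<in> ?V"
    have "(\<Sum>u\<in>?V. (1 + 2 * deg u) * real (d u v)) = S v + 2 * (\<Sum>u\<in>?V. deg u * real (d u v))"
      by (simp add: S_def ring_distribs sum.distrib sum_distrib_left mult.assoc)
    then show "(\<Sum>u\<in>?V. (1 + 2 * deg u) * real (d u v)) = 5 * S v - 2 * ?m"
      by (simp add: sum_deg_dist[OF v] S_def)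
  qed
  also have "\<dots> = 5 * (\<Sum>v\<in>?V. S v) + 10 * (\<Sum>v\<in>?V. deg v * S v) - 2 * ?m * nv - 4 * ?m * (\<Sum>v\<in>?V. real (deg v))"
  proof -
    have "(\<Sum>v\<in>?V. (1 + 2 * deg v) * (5 * S v - 2 * ?m)) =
        (\<Sum>v\<in>?V. 5 * S v + 10 * (deg v * S v) - 2 * ?m - 4 * ?m * deg v)"
      by (intro sum.cong refl) (simp add: algebra_simps)
    then show ?thesis
      by (simp add: sum.distrib sum_subtractf sum_distrib_left[symmetric])
  qed
  finally show ?thesis
    unfolding S kS sum_deg[OF ne] sum_height[OF ne] n'
    by (simp add: power2_eq_square algebra_simps)
qed

end

section \<open>Recursion along the sequence of trees\<close>

lemma (in metric_tree) leaf_attachment_extension: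
  assumes "leaf_attachment G H"
  obtains L p where "leaf_extension G d H L p"
proof -
  obtain L p where *: "finite L \<and> L \<inter> pverts G = {} \<and> p ` L \<subseteq> pverts G \<and>
     (\<forall>v\<in>pverts G. card {w \<in> L. p w = v} = 2 * out_degree (with_proj G) v) \<and>
     pverts H = pverts G \<union> L \<and>
     parcs H = parcs G \<union> {(w, p w) |w. w \<in> L} \<union> {(p w, w) |w. w \<in> L}"
    using assms unfolding leaf_attachment_def by (elim exE)
  have "leaf_extension_axioms G H L p"
  proof
    show "finite L" "L \<inter> pverts G = {}" "p ` L \<subseteq> pverts G" "pverts H = pverts G \<union> L"
      using * by blast+
    show "card {w \<in> L. p w = v} = 2 * deg v" if "v \<in> pverts G" for v
      using * that out_degree_eq_deg by metis
    show "parcs H = parcs G \<union> {(w, p w) |w. w \<in> L} \<union> {(p w, w) |w. w \<in> L}"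
      using * by (elim conjE)
  qed
  with metric_tree_axioms have "leaf_extension G d H L p"
    by (rule leaf_extension.intro)
  then show ?thesis by (rule that)
qed

text \<open>Divided by 25^t, the Wiener index changes at step t by (2/5) m^2 - (6/25) 5^(-t) m;
  summing the geometric series gives the coefficient 3/10. The distance function changes with
  \<open>t\<close>, so the induction carries it existentially.\<close>

lemma leaf_attachment_sequence:
  fixes T :: "nat \<Rightarrow> 'a pair_pre_digraph"
  defines "m \<equiv> real (card (pverts (T 0))) - 1"
  assumes T: "finite_tree (T 0)" "card (pverts (T 0)) \<ge> 2" "\<And>t. leaf_attachment (T t) (T (Suc t))"
  shows "(\<exists>d. metric_tree (T t) d) \<and> real (card (pverts (T t))) = 5 ^ t * m + 1 \<and>
    wiener_index (T t) = 25 ^ t * wiener_index (T 0) + 2 / 5 * real t * 25 ^ t * m\<^sup>2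
      - 3 / 10 * (25 ^ t - 5 ^ t) * m"
proof (induction t)
  case 0
  show ?case
    using finite_tree_metric_tree[OF T(1)] by (auto simp: m_def)
next
  case (Suc t)
  then obtain d where d: "metric_tree (T t) d" by blast
  interpret metric_tree "T t" d by (rule d)
  have card: "nv = 5 ^ t * m + 1" using Suc.IH by blast
  have "m > 0" using T(2) by (simp add: m_def)
  then have "nv > 0" unfolding card by (simp add: add_pos_pos)
  then have ne: "pverts (T t) \<noteq> {}" by auto
  obtain L p where "leaf_extension (T t) d (T (Suc t)) L p"
    using T(3) by (rule leaf_attachment_extension)
  then interpret ext: leaf_extension "T t" d "T (Suc t)" L p .
  have "(5 ^ t * m)\<^sup>2 = 25 ^ t * m\<^sup>2"
    by (simp add: power2_eq_square power_mult_distrib[symmetric])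
  then have "wiener_index (T (Suc t)) = 25 * wiener_index (T t) + 10 * (25 ^ t * m\<^sup>2) - 6 * (5 ^ t * m)"
    using ext.wiener_index_extension[OF ne] card by simp
  moreover have "real (card (pverts (T (Suc t)))) = 5 ^ Suc t * m + 1"
    using ext.card_pverts_extension[OF ne] card by simp
  ultimately show ?case
    using Suc.IH ext.ext_metric_tree by (auto simp: algebra_simps)
qed

section \<open>Order of growth\<close>

lemma mean_hitting_time_asymptotics:
  fixes m W :: real
  assumes m: "m > 0"
  shows "(\<lambda>t::nat. 2 / (5 ^ t * m + 1) *
      (25 ^ t * W + 2 / 5 * real t * 25 ^ t * m\<^sup>2 - 3 / 10 * (25 ^ t - 5 ^ t) * m))
    \<in> \<Theta>(\<lambda>t. (5 ^ t * m + 1) * ln (5 ^ t * m + 1))"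
proof -
  \<comment> \<open>With 25^t pulled out of the bracket, the quotient is of order 5^t and the rest
    is of order t, with leading coefficient (2/5) m^2 > 0 whatever \<open>W\<close> is.\<close>
  have "(\<lambda>t::nat. 2 * (5 ^ t * 5 ^ t) / (5 ^ t * m + 1)) \<in> \<Theta>(\<lambda>t. 5 ^ t)"
    using m by real_asymp
  moreover have "(\<lambda>t::nat. W + 2 / 5 * real t * m\<^sup>2 - 3 / 10 * (1 - (1 / 5) ^ t) * m) \<in> \<Theta>(\<lambda>t. real t)"
    using m by real_asymp
  ultimately have "(\<lambda>t::nat. 2 * (5 ^ t * 5 ^ t) / (5 ^ t * m + 1) *
      (W + 2 / 5 * real t * m\<^sup>2 - 3 / 10 * (1 - (1 / 5) ^ t) * m)) \<in> \<Theta>(\<lambda>t. 5 ^ t * real t)"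
    by (rule landau_theta.mult)
  moreover have "2 * (5 ^ t * 5 ^ t) / (5 ^ t * m + 1) * (W + 2 / 5 * real t * m\<^sup>2 - 3 / 10 * (1 - (1 / 5) ^ t) * m) =
      2 / (5 ^ t * m + 1) * (25 ^ t * W + 2 / 5 * real t * 25 ^ t * m\<^sup>2 - 3 / 10 * (25 ^ t - 5 ^ t) * m)" for t
  proof -
    have *: "5 ^ t = 25 ^ t * (1 / 5 :: real) ^ t" and **: "5 ^ t * 5 ^ t = (25 ^ t :: real)"
      by (simp_all add: power_mult_distrib[symmetric])
    have "A * (W + 2 / 5 * y * m\<^sup>2 - 3 / 10 * (1 - r) * m) =
        A * W + 2 / 5 * y * A * m\<^sup>2 - 3 / 10 * (A - A * r) * m" for A y r :: real
      by (simp add: algebra_simps)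
    from this[of "25 ^ t" "real t" "(1 / 5) ^ t"]
    have "25 ^ t * W + 2 / 5 * real t * 25 ^ t * m\<^sup>2 - 3 / 10 * (25 ^ t - 5 ^ t) * m =
        25 ^ t * (W + 2 / 5 * real t * m\<^sup>2 - 3 / 10 * (1 - (1 / 5) ^ t) * m)"
      unfolding * by (rule sym)
    then show ?thesis
      unfolding ** by (simp only: times_divide_eq_left mult.assoc)
  qed
  ultimately have "(\<lambda>t::nat. 2 / (5 ^ t * m + 1) *
      (25 ^ t * W + 2 / 5 * real t * 25 ^ t * m\<^sup>2 - 3 / 10 * (25 ^ t - 5 ^ t) * m))
      \<in> \<Theta>(\<lambda>t. 5 ^ t * real t)"
    by (simp only:)
  moreover have "(\<lambda>t::nat. (5 ^ t * m + 1) * ln (5 ^ t * m + 1)) \<in> \<Theta>(\<lambda>t. 5 ^ t * real t)"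
    using m by real_asymp
  then have "(\<lambda>t::nat. 5 ^ t * real t) \<in> \<Theta>(\<lambda>t. (5 ^ t * m + 1) * ln (5 ^ t * m + 1))"
    by (rule iffD1[OF bigtheta_sym])
  ultimately show ?thesis
    by (rule landau_theta.trans)
qed

theorem mainTheorem7:
  fixes T :: "nat \<Rightarrow> 'a pair_pre_digraph"
  assumes "finite_tree (T 0)"
    and "card (pverts (T 0)) \<ge> 2"
    and "\<And>t. leaf_attachment (T t) (T (Suc t))"
  shows "(\<forall>t. mean_hitting_time (T t) =
           ennreal (2 / (5 ^ t * (real (card (pverts (T 0))) - 1) + 1) *
             (25 ^ t * wiener_index (T 0)
              + 10 * real t * 5 powi (2 * (int t - 1)) * (real (card (pverts (T 0))) - 1)\<^sup>2
              - 3 * (5 powi (2 * int t - 1) - 5 powi (int t - 1)) / 2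
                  * (real (card (pverts (T 0))) - 1))))
       \<and> (\<lambda>t. enn2real (mean_hitting_time (T t)))
           \<in> \<Theta>(\<lambda>t. real (card (pverts (T t))) * ln (real (card (pverts (T t)))))"
proof -
  define m where "m = real (card (pverts (T 0))) - 1"
  define W where "W = wiener_index (T 0)"
  define x where "x t = 2 / (5 ^ t * m + 1) *
      (25 ^ t * W + 2 / 5 * real t * 25 ^ t * m\<^sup>2 - 3 / 10 * (25 ^ t - 5 ^ t) * m)" for t :: nat
  have m: "m > 0" using assms(2) by (simp add: m_def)
  note seq = leaf_attachment_sequence[OF assms, folded m_def W_def]
  have card: "real (card (pverts (T t))) = 5 ^ t * m + 1" for t
    using seq by blast
  have hit: "mean_hitting_time (T t) = ennreal (x t)" and nonneg: "x t \<ge> 0" for t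
  proof -
    obtain d where "metric_tree (T t) d" using seq by blast
    then interpret metric_tree "T t" d .
    have "1 \<le> m" "m \<le> 5 ^ t * m" using assms(2) m by (simp_all add: m_def)
    then have "real (card (pverts (T t))) \<ge> 2"
      unfolding card by linarith
    then have "card (pverts (T t)) \<ge> 2" by simp
    moreover have x: "x t = 2 * wiener_index (T t) / card (pverts (T t))"
      using seq[of t] by (simp add: x_def)
    ultimately show "mean_hitting_time (T t) = ennreal (x t)"
      by (simp add: mean_hitting_time_eq)
    \<comment> \<open>On negative values \<open>ennreal\<close> is 0; nonnegativity lets
      \<open>enn2real\<close> recover \<open>x t\<close> in the asymptotic claim.\<close>
    show "x t \<ge> 0"
      unfolding x using wiener_index_nonneg by simp
  qed
  \<comment> \<open>At \<open>t = 0\<close> the exponents are negative, hence integer powers. The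
    constants match because 10 / 25 = 2 / 5 and 3 / (2 * 5) = 3 / 10.\<close>
  have x_eq: "x t = 2 / (5 ^ t * m + 1) * (25 ^ t * W + 10 * real t * 5 powi (2 * (int t - 1)) * m\<^sup>2
              - 3 * (5 powi (2 * int t - 1) - 5 powi (int t - 1)) / 2 * m)" for t
  proof -
    have "5 powi (2 * int t) = (25 ^ t :: real)"
      by (simp add: power_int_mult)
    then have *: "5 powi (2 * (int t - 1)) = (25 ^ t / 25 :: real)" "5 powi (2 * int t - 1) = (25 ^ t / 5 :: real)"
      "5 powi (int t - 1) = (5 ^ t / 5 :: real)"
      by (simp_all add: power_int_diff right_diff_distrib)
    show ?thesis
      unfolding x_def * by (intro arg_cong2[where f = "(*)"] refl) (simp add: algebra_simps diff_divide_distrib)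
  qed
  have theta: "x \<in> \<Theta>(\<lambda>t. (5 ^ t * m + 1) * ln (5 ^ t * m + 1))"
    unfolding x_def using m by (rule mean_hitting_time_asymptotics)
  show ?thesis
    unfolding m_def[symmetric] W_def[symmetric]
  proof
    show "\<forall>t. mean_hitting_time (T t) = ennreal (2 / (5 ^ t * m + 1) *
        (25 ^ t * W + 10 * real t * 5 powi (2 * (int t - 1)) * m\<^sup>2
          - 3 * (5 powi (2 * int t - 1) - 5 powi (int t - 1)) / 2 * m))"
      by (simp only: hit x_eq simp_thms)
    show "(\<lambda>t. enn2real (mean_hitting_time (T t)))
        \<in> \<Theta>(\<lambda>t. real (card (pverts (T t))) * ln (real (card (pverts (T t)))))"
      using theta nonneg by (simp add: hit card)
  qed
qed

end
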